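(* The following equalities hold: (a) $$\Big(\liminf_{\alpha\to 1^-}\,\mathrm{co}\,\Gamma_{\alpha}\Big)\cap \mathcal{P}(G)=\Big(\limsup_{\alpha\to 1^-}\,\mathrm{co}\,\Gamma_{\alpha}\Big)\cap \mathcal{P}(G)=W,$$ (b) $$\Big(\liminf_{S\to \infty}\,\mathrm{co}\,\Gamma(S)\Big)\cap \mathcal{P}(G)=\Big(\limsup_{S\to \infty}\,\mathrm{co}\,\Gamma(S)\Big)\cap \mathcal{P}(G)=W,$$ where the lower and upper limits of sets are taken with respect to weak$^*$ convergence in $\mathcal{P}(\bar G)$.
   Context: System. $Y\subset\mathbb{R}^m$ is a nonempty closed unbounded set, $U_0$ is a compact metric space, $U(\cdot):Y\leadsto U_0$ is an upper semicontinuous compact-valued set-valued map, $f:\mathbb{R}^m\times U_0\to\mathbb{R}^m$ is continuous, and $|f(y,u)|\to\infty$ as $|y|\to\infty$ uniformly in $u$. Consider the discrete-time system $y(t+1)=f(y(t),u(t))$, $t=0,1,\dots$, $y(0)=y_0$, $y(t)\in Y$, $u(t)\in U(y(t))$. Let $G=\{(y,u): y\in Y,\ u\in U(y),\ f(y,u)\in Y\}$. A control $u(\cdot)$ and the pair $(y(\cdot),u(\cdot))$ are called admissible if these relations hold; an admissible process satisfies $(y(t),u(t))\in G$ for all $t$ under consideration. $\mathcal{U}(y_0)$ is the set of admissible controls on the infinite horizon, and $\mathcal{U}_S(y_0)$ the set of admissible controls on $\{0,\dots,S-1\}$ ($S$ a positive integer), for the initial condition $y_0$. It is assumed that $\mathcal{U}(y_0)\ne\emptyset$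 for all $y_0\in Y$. Compactification. $\bar Y=Y\cup\{\infty_Y\}$ and $\bar G=G\cup\{\infty_G\}$ are the one-point (Alexandroff) compactifications of $Y$ and $G$. $C(\bar Y)$ and $C(\bar G)$ are the spaces of continuous real functions on them; $\varphi\in C(\bar Y)$ means that $\varphi$ is continuous on $Y$ and has a finite limit $\varphi(\infty_Y)$ as $|y|\to\infty$. $\mathcal{P}(G)$ and $\mathcal{P}(\bar G)$ are the sets of Borel probability measures on $G$ and $\bar G$; $\mathcal{P}(G)$ is identified with the set of measures $\gamma\in\mathcal{P}(\bar G)$ with $\gamma(\{\infty_G\})=0$. Weak$^*$ convergence $\gamma_k\to\gamma$ in $\mathcal{P}(\bar G)$ means $\int_{\bar G}q\,d\gamma_k\to\int_{\bar G}q\,d\gamma$ for all $q\in C(\bar G)$. Occupational measures. For $\alpha\in(0,1)$ and an admissible process on the infinite horizon, the discounted occupational measure is $\gamma^\alpha_u(Q)=(1-\alpha)\sum_{t=0}^\infty\alpha^t 1_Q(y(t),u(t))$ for Borel $Q\subset G$; for an admissible process on $\{0,\dots,S-1\}$ the averaging occupational measure is $\gamma_{u,S}(Q)=\frac1S\sum_{t=0}^{S-1}1_Q(y(t),u(t))$. Put $\Gamma_\alpha(y_0)=\{\gamma^\alpha_u: u(\cdot)\in\mathcal{U}(y_0)\}$, $\Gamma(S,y_0)=\{\gamma_{u,S}:u(\cdot)\in\mathcal{U}_S(y_0)\}$, $\Gamma_\alpha=\bigcup_{y_0\in Y}\Gamma_\alpha(y_0)$, $\Gamma(S)=\bigcup_{y_0\in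 Y}\Gamma(S,y_0)$. $\mathrm{co}$ denotes the convex hull. The set $W$ is $$W=\Big\{\gamma\in\mathcal{P}(G): \int_G(\varphi(f(y,u))-\varphi(y))\,d\gamma=0\ \ \forall\varphi\in C(\bar Y)\Big\}.$$ Limits of sets. For sets $A_\alpha\subset\mathcal{P}(\bar G)$, $\liminf_{\alpha\to1^-}A_\alpha$ is the set of $\gamma\in\mathcal{P}(\bar G)$ such that for every sequence $\alpha_k\to1^-$ there exist $\gamma_k\in A_{\alpha_k}$ with $\gamma_k\to\gamma$ weakly$^*$; $\limsup_{\alpha\to1^-}A_\alpha$ is the set of $\gamma\in\mathcal{P}(\bar G)$ for which there exist a sequence $\alpha_k\to1^-$ and $\gamma_k\in A_{\alpha_k}$ with $\gamma_k\to\gamma$ weakly$^*$. The limits as $S\to\infty$ are defined analogously. *)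

theory Defs
  imports "HOL-Probability.Probability"
begin

section \<open>Borel probability measures on a topological space\<close>

definition borel_of :: "'a topology \<Rightarrow> 'a measure" where
  "borel_of X = sigma (topspace X) {S. openin X S}"

definition borel_prob :: "'a topology \<Rightarrow> 'a measure set" where
  "borel_prob X = {\<gamma>. sets \<gamma> = sets (borel_of X) \<and> prob_space \<gamma>}"

definition weak_star_conv :: "'a topology \<Rightarrow> (nat \<Rightarrow> 'a measure) \<Rightarrow> 'a measure \<Rightarrow> bool" where
  "weak_star_conv X \<mu> \<gamma> \<longleftrightarrow>
     (\<forall>q. continuous_map X euclideanreal q \<longrightarrow>
        (\<lambda>k. integral\<^sup>L (\<mu> k) q) \<longlonglongrightarrow> integral\<^sup>L \<gamma> q)"

text \<open>Measures do not form a vector space in HOL, so the convex hull is spelled out through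
  finite convex combinations, in the manner of \<open>convex_hull_explicit\<close>.\<close>

definition co :: "'a topology \<Rightarrow> 'a measure set \<Rightarrow> 'a measure set" where
  "co X A = {\<gamma> \<in> borel_prob X. \<exists>F w. finite F \<and> F \<subseteq> A \<and> (\<forall>\<nu>\<in>F. 0 \<le> w \<nu>) \<and> sum w F = 1 \<and>
     (\<forall>Q\<in>sets (borel_of X). measure \<gamma> Q = (\<Sum>\<nu>\<in>F. w \<nu> * measure \<nu> Q))}"

text \<open>Lower and upper limits of a family of sets of measures, along sequences of parameters
  in \<open>I\<close> that converge in the sense of the filter \<open>F\<close>.\<close>

definition set_liminf ::
    "'a topology \<Rightarrow> 'p set \<Rightarrow> 'p filter \<Rightarrow> ('p \<Rightarrow> 'a measure set) \<Rightarrow> 'a measure set" where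
  "set_liminf X I F A = {\<gamma> \<in> borel_prob X.
     \<forall>s. (\<forall>k. s k \<in> I) \<and> filterlim s F sequentially \<longrightarrow>
       (\<exists>\<mu>. (\<forall>k. \<mu> k \<in> A (s k)) \<and> weak_star_conv X \<mu> \<gamma>)}"

definition set_limsup ::
    "'a topology \<Rightarrow> 'p set \<Rightarrow> 'p filter \<Rightarrow> ('p \<Rightarrow> 'a measure set) \<Rightarrow> 'a measure set" where
  "set_limsup X I F A = {\<gamma> \<in> borel_prob X.
     \<exists>s. (\<forall>k. s k \<in> I) \<and> filterlim s F sequentially \<and>
       (\<exists>\<mu>. (\<forall>k. \<mu> k \<in> A (s k)) \<and> weak_star_conv X \<mu> \<gamma>)}"

section \<open>One-point compactification and identification of measures\<close>

abbreviation compactif :: "'a::topological_space set \<Rightarrow> 'a option topology" where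
  "compactif G \<equiv> Alexandroff_compactification (top_of_set G)"

text \<open>The point at infinity is \<open>None\<close>. A probability measure on \<open>G\<close> is identified with its
  image under \<open>Some\<close>; the resulting copy of the probability measures on \<open>G\<close> consists of the
  measures on the compactification that do not charge \<open>None\<close>.\<close>

definition ext_measure :: "'a::topological_space set \<Rightarrow> 'a measure \<Rightarrow> 'a option measure" where
  "ext_measure G \<gamma> = distr \<gamma> (borel_of (compactif G)) Some"

definition prob_no_infinity :: "'a::topological_space set \<Rightarrow> 'a option measure set" where
  "prob_no_infinity G = {\<gamma> \<in> borel_prob (compactif G). measure \<gamma> {None} = 0}"

section \<open>The control system\<close>

definition usc_on :: "'a::metric_space set \<Rightarrow> ('a \<Rightarrow> 'b::metric_space set) \<Rightarrow> bool" where
  "usc_on Y U \<longleftrightarrow> (\<forall>y\<in>Y. \<forall>V. open V \<and> U y \<subseteq> V \<longrightarrow>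
     (\<exists>\<delta>>0. \<forall>y'\<in>Y. dist y' y < \<delta> \<longrightarrow> U y' \<subseteq> V))"

definition graph_G :: "'a set \<Rightarrow> ('a \<Rightarrow> 'u set) \<Rightarrow> ('a \<times> 'u \<Rightarrow> 'a) \<Rightarrow> ('a \<times> 'u) set" where
  "graph_G Y U f = {(y, u). y \<in> Y \<and> u \<in> U y \<and> f (y, u) \<in> Y}"

primrec trajectory :: "('a \<times> 'u \<Rightarrow> 'a) \<Rightarrow> 'a \<Rightarrow> (nat \<Rightarrow> 'u) \<Rightarrow> nat \<Rightarrow> 'a" where
  "trajectory f y0 u 0 = y0"
| "trajectory f y0 u (Suc t) = f (trajectory f y0 u t, u t)"

definition process :: "('a \<times> 'u \<Rightarrow> 'a) \<Rightarrow> 'a \<Rightarrow> (nat \<Rightarrow> 'u) \<Rightarrow> nat \<Rightarrow> 'a \<times> 'u" where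
  "process f y0 u t = (trajectory f y0 u t, u t)"

definition controls ::
    "'a set \<Rightarrow> ('a \<Rightarrow> 'u set) \<Rightarrow> ('a \<times> 'u \<Rightarrow> 'a) \<Rightarrow> 'a \<Rightarrow> (nat \<Rightarrow> 'u) set" where
  "controls Y U f y0 =
     {u. \<forall>t. trajectory f y0 u t \<in> Y \<and> u t \<in> U (trajectory f y0 u t)}"

text \<open>On the horizon \<open>{0..S-1}\<close> membership of the process in \<open>G\<close> also forces the state
  at time \<open>S\<close> to lie in \<open>Y\<close>. Only the values of \<open>u\<close> before time \<open>S\<close> matter.\<close>

definition controls_fin ::
    "'a set \<Rightarrow> ('a \<Rightarrow> 'u set) \<Rightarrow> ('a \<times> 'u \<Rightarrow> 'a) \<Rightarrow> nat \<Rightarrow> 'a \<Rightarrow> (nat \<Rightarrow> 'u) set" where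
  "controls_fin Y U f S y0 = {u. \<forall>t<S. process f y0 u t \<in> graph_G Y U f}"

section \<open>Occupational measures\<close>

definition disc_occ :: "'a::topological_space set \<Rightarrow> real \<Rightarrow> (nat \<Rightarrow> 'a) \<Rightarrow> 'a measure" where
  "disc_occ G \<alpha> z = measure_of G (sets (borel_of (top_of_set G)))
     (\<lambda>Q. ennreal ((1 - \<alpha>) * (\<Sum>t. \<alpha> ^ t * indicator Q (z t))))"

definition avg_occ :: "'a::topological_space set \<Rightarrow> nat \<Rightarrow> (nat \<Rightarrow> 'a) \<Rightarrow> 'a measure" where
  "avg_occ G S z = measure_of G (sets (borel_of (top_of_set G)))
     (\<lambda>Q. ennreal (1 / real S * (\<Sum>t<S. indicator Q (z t))))"

definition Gamma_disc :: "'a::topological_space set \<Rightarrow> ('a \<Rightarrow> 'u::topological_space set)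
    \<Rightarrow> ('a \<times> 'u \<Rightarrow> 'a) \<Rightarrow> real \<Rightarrow> ('a \<times> 'u) measure set" where
  "Gamma_disc Y U f \<alpha> =
     (\<Union>y0\<in>Y. {disc_occ (graph_G Y U f) \<alpha> (process f y0 u) | u. u \<in> controls Y U f y0})"

definition Gamma_avg :: "'a::topological_space set \<Rightarrow> ('a \<Rightarrow> 'u::topological_space set)
    \<Rightarrow> ('a \<times> 'u \<Rightarrow> 'a) \<Rightarrow> nat \<Rightarrow> ('a \<times> 'u) measure set" where
  "Gamma_avg Y U f S =
     (\<Union>y0\<in>Y. {avg_occ (graph_G Y U f) S (process f y0 u) | u. u \<in> controls_fin Y U f S y0})"

definition W :: "'a::topological_space set \<Rightarrow> ('a \<Rightarrow> 'u::topological_space set)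
    \<Rightarrow> ('a \<times> 'u \<Rightarrow> 'a) \<Rightarrow> ('a \<times> 'u) measure set" where
  "W Y U f = {\<gamma> \<in> borel_prob (top_of_set (graph_G Y U f)).
     \<forall>\<phi>. continuous_map (compactif Y) euclideanreal \<phi> \<longrightarrow>
       (\<integral>(y, u). \<phi> (Some (f (y, u))) - \<phi> (Some y) \<partial>\<gamma>) = 0}"

section \<open>Consistency checks\<close>

lemma space_borel_of: "space (borel_of X) = topspace X"
  by (simp add: borel_of_def space_measure_of_conv)

lemma sets_borel_of: "sets (borel_of X) = sigma_sets (topspace X) {S. openin X S}"
  unfolding borel_of_def by (rule sets_measure_of) (auto dest: openin_subset)

lemma sets_borel_of_top_of_set:
  "sets (borel_of (top_of_set G)) = sets (restrict_space borel G)"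
proof -
  have "sets (restrict_space borel G) = (\<inter>) G ` sigma_sets UNIV {S. open S}"
    by (simp add: sets_restrict_space borel_def)
  also have "\<dots> = {(\<lambda>x. x) -` A \<inter> G | A. A \<in> sigma_sets UNIV {S. open S}}"
    by auto
  also have "\<dots> = sigma_sets G {(\<lambda>x. x) -` A \<inter> G | A. A \<in> {S. open S}}"
    by (rule sigma_sets_vimage_commute) auto
  also have "{(\<lambda>x. x) -` A \<inter> G | A. A \<in> {S. open S}} = (\<inter>) G ` {S. open S}"
    by auto
  finally have "sets (restrict_space borel G) = sigma_sets G ((\<inter>) G ` {S. open S})" .
  moreover have "(\<inter>) G ` {S. open S} = {S. openin (top_of_set G) S}"
    by (auto simp: openin_open)
  ultimately show ?thesis by (simp add: sets_borel_of)
qed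

lemma continuous_map_borel_of:
  assumes "continuous_map X euclidean q"
  shows "q \<in> borel_measurable (borel_of X)"
proof (rule borel_measurableI)
  fix S :: "'b set" assume "open S"
  then have "openin X (q -` S \<inter> topspace X)"
    using assms by (auto simp: continuous_map_def vimage_def Int_def conj_commute)
  then show "q -` S \<inter> space (borel_of X) \<in> sets (borel_of X)"
    by (auto simp: space_borel_of sets_borel_of)
qed

lemma Some_measurable: "Some \<in> measurable (borel_of (top_of_set G)) (borel_of (compactif G))"
proof (unfold borel_of_def[of "compactif G"], rule measurable_measure_of)
  show "{S. openin (compactif G) S} \<subseteq> Pow (topspace (compactif G))"
    using openin_subset by blast
  show "Some \<in> space (borel_of (top_of_set G)) \<rightarrow> topspace (compactif G)"
    by (simp add: space_borel_of)
  fix V assume "V \<in> {S. openin (compactif G) S}"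
  then have "openin (top_of_set G) {x \<in> G. Some x \<in> V}"
    using continuous_map_Some[of "top_of_set G"] by (auto simp: continuous_map_def)
  moreover have "{x \<in> G. Some x \<in> V} = Some -` V \<inter> space (borel_of (top_of_set G))"
    by (auto simp: space_borel_of)
  ultimately show "Some -` V \<inter> space (borel_of (top_of_set G)) \<in> sets (borel_of (top_of_set G))"
    by (auto simp: sets_borel_of)
qed

lemma ext_measure_in:
  assumes "\<gamma> \<in> borel_prob (top_of_set G)"
  shows "ext_measure G \<gamma> \<in> prob_no_infinity G"
proof -
  have s: "sets \<gamma> = sets (borel_of (top_of_set G))" and p: "prob_space \<gamma>"
    using assms by (auto simp: borel_prob_def)
  have m: "Some \<in> measurable \<gamma> (borel_of (compactif G))"
    using Some_measurable measurable_cong_sets[OF s refl] by blast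
  have "measure (ext_measure G \<gamma>) {None} = 0"
  proof (cases "{None} \<in> sets (borel_of (compactif G))")
    case True
    have "Some -` {None} \<inter> space \<gamma> = {}" by auto
    then show ?thesis using True m by (simp add: ext_measure_def measure_distr)
  next
    case False
    then show ?thesis by (simp add: ext_measure_def measure_notin_sets)
  qed
  then show ?thesis
    using prob_space.prob_space_distr[OF p m]
    by (auto simp: prob_no_infinity_def borel_prob_def ext_measure_def)
qed

lemma
  assumes z: "\<And>t. z t \<in> G" and a: "0 < \<alpha>" "\<alpha> < 1"
  shows emeasure_disc_occ: "Q \<in> sets (borel_of (top_of_set G)) \<Longrightarrow>
      emeasure (disc_occ G \<alpha> z) Q = ennreal ((1 - \<alpha>) * (\<Sum>t. \<alpha> ^ t * indicator Q (z t)))"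
    and disc_occ_prob: "disc_occ G \<alpha> z \<in> borel_prob (top_of_set G)"
proof -
  let ?B = "borel_of (top_of_set G)"
  let ?m = "\<lambda>Q. ennreal ((1 - \<alpha>) * (\<Sum>t. \<alpha> ^ t * indicator Q (z t)))"
  let ?D = "density (count_space UNIV) (\<lambda>t. ennreal ((1 - \<alpha>) * \<alpha> ^ t))"
  have zm: "z \<in> measurable ?D ?B" using z by (auto simp: space_borel_of)
  have eq: "emeasure (distr ?D ?B z) Q = ?m Q" if "Q \<in> sets ?B" for Q
  proof -
    have sm: "summable (\<lambda>t. (1 - \<alpha>) * (\<alpha> ^ t * indicator Q (z t)))"
      by (intro summable_mult summable_comparison_test[OF _ summable_geometric[of \<alpha>]])
        (use a in \<open>auto simp: indicator_def\<close>)
    have "emeasure (distr ?D ?B z) Q = emeasure ?D (z -` Q)"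
      using zm that by (simp add: emeasure_distr)
    also have "\<dots> = (\<integral>\<^sup>+t. ennreal ((1 - \<alpha>) * \<alpha> ^ t) * indicator (z -` Q) t \<partial>count_space UNIV)"
      by (simp add: emeasure_density)
    also have "\<dots> = (\<Sum>t. ennreal ((1 - \<alpha>) * (\<alpha> ^ t * indicator Q (z t))))"
      unfolding nn_integral_count_space_nat
      by (intro suminf_cong) (auto simp: indicator_def)
    also have "\<dots> = ennreal (\<Sum>t. (1 - \<alpha>) * (\<alpha> ^ t * indicator Q (z t)))"
      using a by (intro suminf_ennreal2 sm) auto
    also have "(\<Sum>t. (1 - \<alpha>) * (\<alpha> ^ t * indicator Q (z t)))
        = (1 - \<alpha>) * (\<Sum>t. \<alpha> ^ t * indicator Q (z t))"
      using sm a by (intro suminf_mult) (simp add: summable_mult_D)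
    finally show ?thesis .
  qed
  have GP: "sets ?B \<subseteq> Pow G" using sets.sets_into_space[of _ ?B] by (auto simp: space_borel_of)
  have sa: "sigma_sets G (sets ?B) = sets ?B"
    using sets.sigma_sets_eq[of ?B] by (simp add: space_borel_of)
  have "distr ?D ?B z = measure_of G (sets ?B) (emeasure (distr ?D ?B z))"
    using measure_of_of_measure[of "distr ?D ?B z"] by (simp add: space_borel_of)
  also have "\<dots> = disc_occ G \<alpha> z"
    unfolding disc_occ_def by (rule measure_of_eq[OF GP]) (simp add: sa eq)
  finally have d: "disc_occ G \<alpha> z = distr ?D ?B z" ..
  show "emeasure (disc_occ G \<alpha> z) Q = ?m Q" if "Q \<in> sets ?B"
    using eq[OF that] d by simp
  have top: "G \<in> sets ?B" using sets.top[of ?B] by (simp add: space_borel_of)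
  have "emeasure (distr ?D ?B z) G = 1"
    using a z by (simp add: eq[OF top] suminf_geometric)
  then have "prob_space (distr ?D ?B z)" by (intro prob_spaceI) (simp add: space_borel_of)
  then show "disc_occ G \<alpha> z \<in> borel_prob (top_of_set G)" by (simp add: borel_prob_def d)
qed

lemma
  assumes z: "\<And>t. t < S \<Longrightarrow> z t \<in> G" and S: "0 < S"
  shows emeasure_avg_occ: "Q \<in> sets (borel_of (top_of_set G)) \<Longrightarrow>
      emeasure (avg_occ G S z) Q = ennreal (1 / real S * (\<Sum>t<S. indicator Q (z t)))"
    and avg_occ_prob: "avg_occ G S z \<in> borel_prob (top_of_set G)"
proof -
  let ?B = "borel_of (top_of_set G)"
  let ?m = "\<lambda>Q. ennreal (1 / real S * (\<Sum>t<S. indicator Q (z t)))"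
  let ?D = "density (count_space {..<S}) (\<lambda>t. ennreal (1 / real S))"
  have zm: "z \<in> measurable ?D ?B" using z by (auto simp: space_borel_of)
  have eq: "emeasure (distr ?D ?B z) Q = ?m Q" if "Q \<in> sets ?B" for Q
  proof -
    have "emeasure (distr ?D ?B z) Q = emeasure ?D (z -` Q \<inter> {..<S})"
      using zm that by (simp add: emeasure_distr)
    also have "\<dots> = (\<integral>\<^sup>+t. ennreal (1 / real S) * indicator (z -` Q \<inter> {..<S}) t \<partial>count_space {..<S})"
      by (subst emeasure_density) auto
    also have "\<dots> = (\<Sum>t<S. ennreal (1 / real S * indicator Q (z t)))"
      unfolding nn_integral_count_space_finite[OF finite_lessThan]
      by (intro sum.cong) (auto simp: indicator_def)
    also have "\<dots> = ennreal (\<Sum>t<S. 1 / real S * indicator Q (z t))"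
      by (intro sum_ennreal) auto
    finally show ?thesis by (simp add: sum_distrib_left)
  qed
  have GP: "sets ?B \<subseteq> Pow G" using sets.sets_into_space[of _ ?B] by (auto simp: space_borel_of)
  have sa: "sigma_sets G (sets ?B) = sets ?B"
    using sets.sigma_sets_eq[of ?B] by (simp add: space_borel_of)
  have "distr ?D ?B z = measure_of G (sets ?B) (emeasure (distr ?D ?B z))"
    using measure_of_of_measure[of "distr ?D ?B z"] by (simp add: space_borel_of)
  also have "\<dots> = avg_occ G S z"
    unfolding avg_occ_def by (rule measure_of_eq[OF GP]) (simp add: sa eq)
  finally have d: "avg_occ G S z = distr ?D ?B z" ..
  show "emeasure (avg_occ G S z) Q = ?m Q" if "Q \<in> sets ?B"
    using eq[OF that] d by simp
  have top: "G \<in> sets ?B" using sets.top[of ?B] by (simp add: space_borel_of)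
  have "emeasure (distr ?D ?B z) G = 1"
    using S z by (simp add: eq[OF top])
  then have "prob_space (distr ?D ?B z)" by (intro prob_spaceI) (simp add: space_borel_of)
  then show "avg_occ G S z \<in> borel_prob (top_of_set G)" by (simp add: borel_prob_def d)
qed

end

theory Submission
  imports Defs
begin

text \<open>
  Weak* convergence is tested on continuous functions of the compactification. For continuous
  \<open>\<phi>\<close> on the compactified state space, the increment \<open>\<phi> (f (y, u)) - \<phi> y\<close> extends continuously to
  the compactified graph, with value 0 at infinity, because \<open>f\<close> tends to infinity with \<open>y\<close>
  (\<open>continuous_map_increment\<close>). Its integral against an occupational measure telescopes to
  \<open>O(1 - \<alpha>)\<close> in the discounted case and \<open>O(1 / S)\<close> in the averaged case
  (\<open>Gamma_disc_increment\<close>, \<open>Gamma_avg_increment\<close>). These bounds pass to convex combinations, so a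
  limit point that does not charge infinity annihilates all increments, which is membership in \<open>W\<close>
  (\<open>set_limsup_subset_W\<close>).

  The converse inclusion holds for each single parameter: every \<open>\<gamma> \<in> W\<close> is a weak limit of elements
  of \<open>co \<Gamma>\<^sub>\<alpha>\<close>, and of \<open>co \<Gamma>(S)\<close>, for fixed \<open>\<alpha>\<close> and \<open>S\<close>. By convex duality this reduces to the
  inequality \<open>\<integral>q d\<gamma> \<le> sup {\<integral>q d\<nu> | \<nu> \<in> \<Gamma>}\<close> for bounded continuous \<open>q\<close>, and dynamic programming
  proves the latter. The finite horizon value function \<open>V\<^sub>n\<close> satisfies
  \<open>V\<^sub>n\<^sub>+\<^sub>1 y \<ge> q (y, u) + \<alpha> V\<^sub>n (f (y, u))\<close> on the graph. Integrating against \<open>\<gamma>\<close>, whose images under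
  \<open>f\<close> and under the projection to the state coincide (\<open>invariant_distr\<close>), gives
  \<open>\<integral>V\<^sub>n d\<gamma> \<ge> (1 + \<alpha> + \<dots> + \<alpha>\<^sup>n\<^sup>-\<^sup>1) \<integral>q d\<gamma>\<close> by induction (\<open>integral_horizon_value_ge\<close>), and a
  near-optimal process starting where \<open>V\<^sub>n\<close> is at least its mean is the required one
  (\<open>exists_process_ge_integral\<close>). Compactness of the controls makes \<open>V\<^sub>n\<close> upper
  semicontinuous, hence measurable (\<open>closed_superlevel_horizon_value\<close>).

  The duality step is carried out in finitely many coordinates by a line search argument
  (\<open>convex_moment_approximation\<close>). It applies to countably many test functions, namely finite
  maxima of cones, which determine weak convergence on a separable metric space
  (\<open>cone_max_convergence_determining\<close>).
\<close>

section \<open>Mixtures of probability measures and integrals against occupational measures\<close>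

lemma sets_borel_prob: "\<gamma> \<in> borel_prob X \<Longrightarrow> sets \<gamma> = sets (borel_of X)"
  and prob_space_borel_prob: "\<gamma> \<in> borel_prob X \<Longrightarrow> prob_space \<gamma>"
  by (auto simp: borel_prob_def)

lemma space_borel_prob: "\<gamma> \<in> borel_prob X \<Longrightarrow> space \<gamma> = topspace X"
  using sets_eq_imp_space_eq[OF sets_borel_prob] by (simp add: space_borel_of)

lemma measurable_borel_prob: "\<gamma> \<in> borel_prob X \<Longrightarrow> measurable \<gamma> N = measurable (borel_of X) N"
  by (rule measurable_cong_sets[OF sets_borel_prob refl])

lemma integrable_borel_prob:
  fixes h :: "'a \<Rightarrow> real"
  assumes "\<gamma> \<in> borel_prob X" "h \<in> borel_measurable (borel_of X)"
    and "\<And>x. x \<in> topspace X \<Longrightarrow> \<bar>h x\<bar> \<le> C"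
  shows "integrable \<gamma> h"
proof -
  interpret prob_space \<gamma> by (rule prob_space_borel_prob[OF assms(1)])
  show ?thesis
    using assms by (intro integrable_const_bound[of _ C] AE_I2)
      (auto simp: space_borel_prob measurable_borel_prob)
qed

lemma abs_integral_borel_prob_le:
  fixes h :: "'a \<Rightarrow> real"
  assumes "\<gamma> \<in> borel_prob X" "h \<in> borel_measurable (borel_of X)" "\<And>x. x \<in> topspace X \<Longrightarrow> \<bar>h x\<bar> \<le> C"
  shows "\<bar>integral\<^sup>L \<gamma> h\<bar> \<le> C"
proof -
  interpret prob_space \<gamma> by (rule prob_space_borel_prob[OF assms(1)])
  have "integrable \<gamma> h" by (rule integrable_borel_prob[OF assms])
  then have "\<bar>integral\<^sup>L \<gamma> h\<bar> \<le> (\<integral>x. C \<partial>\<gamma>)"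
    using assms(3) space_borel_prob[OF assms(1)]
    by (intro order_trans[OF integral_abs_bound integral_mono]) auto
  then show ?thesis by (simp add: prob_space)
qed

lemma integral_indicator_borel_prob:
  "\<gamma> \<in> borel_prob X \<Longrightarrow> Q \<in> sets (borel_of X) \<Longrightarrow> integral\<^sup>L \<gamma> (indicator Q) = measure \<gamma> Q"
  by (metis Bochner_Integration.integral_indicator sets.Int_space_eq2 sets_borel_prob)

text \<open>A mixture \<open>\<integral> \<nu>\<^sub>i dp(i)\<close> over a discrete index distribution is the monadic bind, for which
  iterated integration is known. Occupational measures and finite convex combinations are both of
  this form, with point masses or the combined measures as \<open>\<nu>\<^sub>i\<close>.\<close>
lemma
  fixes p :: "'i pmf" and h :: "'a \<Rightarrow> real"
  assumes \<nu>: "\<And>i. \<nu> i \<in> borel_prob X"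
  shows bind_pmf_borel_prob: "measure_pmf p \<bind> \<nu> \<in> borel_prob X"
    and integral_bind_pmf_borel_prob:
      "h \<in> borel_measurable (borel_of X) \<Longrightarrow> (\<And>x. x \<in> topspace X \<Longrightarrow> \<bar>h x\<bar> \<le> C) \<Longrightarrow>
        integral\<^sup>L (measure_pmf p \<bind> \<nu>) h = (\<integral>i. integral\<^sup>L (\<nu> i) h \<partial>p)"
proof -
  have m: "\<nu> \<in> measurable (measure_pmf p) (subprob_algebra (borel_of X))"
    using \<nu> by (auto simp: space_subprob_algebra borel_prob_def intro: prob_space_imp_subprob_space)
  have "\<nu> \<in> measurable (measure_pmf p) (prob_algebra (borel_of X))"
    using \<nu> by (auto simp: space_prob_algebra borel_prob_def)
  then have "prob_space (measure_pmf p \<bind> \<nu>)"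
    by (intro prob_space_bind'[of _ "measure_pmf p"])
      (auto simp: space_prob_algebra intro: measure_pmf.prob_space_axioms)
  moreover have "sets (measure_pmf p \<bind> \<nu>) = sets (borel_of X)"
    by (rule sets_bind[OF sets_kernel[OF m]]) auto
  ultimately show "measure_pmf p \<bind> \<nu> \<in> borel_prob X" by (simp add: borel_prob_def)
  show "integral\<^sup>L (measure_pmf p \<bind> \<nu>) h = (\<integral>i. integral\<^sup>L (\<nu> i) h \<partial>p)"
    if "h \<in> borel_measurable (borel_of X)" "\<And>x. x \<in> topspace X \<Longrightarrow> \<bar>h x\<bar> \<le> C"
    using that \<nu>
    by (intro integral_bind[OF _ _ m, of _ C 1])
      (auto simp: space_borel_of borel_prob_def prob_space.emeasure_space_1
        intro: measure_pmf.finite_measure)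
qed

text \<open>A measure with the values of a mixture on measurable sets is equal to that mixture. This turns
  setwise descriptions, such as the one in the convex hull, into formulas for integrals.\<close>
lemma integral_mixture:
  fixes p :: "'i pmf" and h :: "'a \<Rightarrow> real"
  assumes \<gamma>: "\<gamma> \<in> borel_prob X" and \<nu>: "\<And>i. \<nu> i \<in> borel_prob X"
    and eq: "\<And>Q. Q \<in> sets (borel_of X) \<Longrightarrow> measure \<gamma> Q = (\<integral>i. measure (\<nu> i) Q \<partial>p)"
    and h: "h \<in> borel_measurable (borel_of X)" "\<And>x. x \<in> topspace X \<Longrightarrow> \<bar>h x\<bar> \<le> C"
  shows "integral\<^sup>L \<gamma> h = (\<integral>i. integral\<^sup>L (\<nu> i) h \<partial>p)"
proof -
  let ?M = "measure_pmf p \<bind> \<nu>"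
  have M: "?M \<in> borel_prob X" by (rule bind_pmf_borel_prob[OF \<nu>])
  interpret \<gamma>: prob_space \<gamma> by (rule prob_space_borel_prob[OF \<gamma>])
  interpret M: prob_space ?M by (rule prob_space_borel_prob[OF M])
  have meas: "measure ?M Q = measure \<gamma> Q" if Q: "Q \<in> sets (borel_of X)" for Q
  proof -
    have "measure ?M Q = integral\<^sup>L ?M (indicator Q)"
      by (rule integral_indicator_borel_prob[OF M Q, symmetric])
    also have "\<dots> = (\<integral>i. integral\<^sup>L (\<nu> i) (indicator Q) \<partial>p)"
      using Q by (intro integral_bind_pmf_borel_prob[OF \<nu>, of _ 1]) (auto simp: indicator_def)
    also have "\<dots> = (\<integral>i. measure (\<nu> i) Q \<partial>p)"
      by (simp only: integral_indicator_borel_prob[OF \<nu> Q])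
    finally show ?thesis using eq[OF Q] by simp
  qed
  have "\<gamma> = ?M"
    using \<gamma> M meas
    by (intro measure_eqI) (auto simp: sets_borel_prob \<gamma>.emeasure_eq_measure M.emeasure_eq_measure)
  then show ?thesis using integral_bind_pmf_borel_prob[OF \<nu> h] by simp
qed

lemma pmf_of_weights:
  fixes w :: "'i \<Rightarrow> real"
  assumes "finite F" "\<And>i. i \<in> F \<Longrightarrow> 0 \<le> w i" "sum w F = 1"
  obtains p :: "'i pmf" where "\<And>g :: 'i \<Rightarrow> real. (\<integral>i. g i \<partial>p) = (\<Sum>i\<in>F. w i * g i)"
proof -
  let ?w = "\<lambda>i. if i \<in> F then w i else 0"
  have nn: "\<And>i. 0 \<le> ?w i" using assms by auto
  have "(\<integral>\<^sup>+i. ?w i \<partial>count_space UNIV) = (\<Sum>i\<in>F. ennreal (w i))"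
    using assms(1) by (subst nn_integral_count_space'[of F]) auto
  also have "\<dots> = 1" using assms by (simp add: sum_ennreal)
  finally have 1: "(\<integral>\<^sup>+i. ?w i \<partial>count_space UNIV) = 1" .
  let ?p = "embed_pmf ?w"
  have "(\<integral>i. g i \<partial>?p) = (\<Sum>i\<in>F. w i * g i)" for g :: "'i \<Rightarrow> real"
    using set_embed_pmf[OF nn 1] assms(1)
    by (subst integral_measure_pmf[of F])
      (auto simp: pmf_embed_pmf[OF nn 1] split: if_splits)
  then show ?thesis by (rule that)
qed

lemma integral_convex_combination:
  fixes h :: "'a \<Rightarrow> real"
  assumes \<gamma>: "\<gamma> \<in> borel_prob X" and F: "finite F" "F \<subseteq> borel_prob X"
    and w: "\<forall>\<nu>\<in>F. 0 \<le> w \<nu>" "sum w F = 1"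
    and eq: "\<forall>Q\<in>sets (borel_of X). measure \<gamma> Q = (\<Sum>\<nu>\<in>F. w \<nu> * measure \<nu> Q)"
    and h: "h \<in> borel_measurable (borel_of X)" "\<And>x. x \<in> topspace X \<Longrightarrow> \<bar>h x\<bar> \<le> C"
  shows "integral\<^sup>L \<gamma> h = (\<Sum>\<nu>\<in>F. w \<nu> * integral\<^sup>L \<nu> h)"
proof -
  obtain p :: "'a measure pmf" where p: "\<And>g :: _ \<Rightarrow> real. (\<integral>i. g i \<partial>p) = (\<Sum>i\<in>F. w i * g i)"
    using pmf_of_weights[OF F(1), of w] w by blast
  \<comment> \<open>The kernel must consist of probability measures at every index; \<open>\<gamma>\<close> is a dummy value of weight 0.\<close>
  let ?\<nu> = "\<lambda>\<nu>. if \<nu> \<in> F then \<nu> else \<gamma>"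
  have "integral\<^sup>L \<gamma> h = (\<integral>\<nu>. integral\<^sup>L (?\<nu> \<nu>) h \<partial>p)"
    using F \<gamma> eq by (intro integral_mixture[OF \<gamma> _ _ h]) (auto simp: p intro!: sum.cong)
  then show ?thesis by (simp add: p cong: sum.cong)
qed

text \<open>The hull \<open>co\<close> only names measures that already exist; here the measure with the prescribed
  combination of values is constructed, together with its integrals.\<close>
lemma convex_combination_in_co:
  assumes F: "finite F" "F \<subseteq> A" and A: "A \<subseteq> borel_prob X"
    and w: "\<forall>\<nu>\<in>F. 0 \<le> w \<nu>" "sum w F = 1"
  obtains \<gamma> where "\<gamma> \<in> co X A"
    and "\<And>(h :: 'a \<Rightarrow> real) C. h \<in> borel_measurable (borel_of X) \<Longrightarrow> (\<And>x. x \<in> topspace X \<Longrightarrow> \<bar>h x\<bar> \<le> C) \<Longrightarrow>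
      integral\<^sup>L \<gamma> h = (\<Sum>\<nu>\<in>F. w \<nu> * integral\<^sup>L \<nu> h)"
proof -
  obtain p :: "'a measure pmf" where p: "\<And>g :: _ \<Rightarrow> real. (\<integral>i. g i \<partial>p) = (\<Sum>i\<in>F. w i * g i)"
    using pmf_of_weights[OF F(1), of w] w by blast
  have "F \<noteq> {}" using w by auto
  then obtain \<nu>0 where \<nu>0: "\<nu>0 \<in> F" by blast
  let ?\<nu> = "\<lambda>\<nu>. if \<nu> \<in> F then \<nu> else \<nu>0"
  have \<nu>: "\<And>\<nu>. ?\<nu> \<nu> \<in> borel_prob X" using \<nu>0 F A by auto
  let ?\<gamma> = "measure_pmf p \<bind> ?\<nu>"
  have \<gamma>: "?\<gamma> \<in> borel_prob X" by (rule bind_pmf_borel_prob[OF \<nu>])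
  have int: "integral\<^sup>L ?\<gamma> h = (\<Sum>\<nu>\<in>F. w \<nu> * integral\<^sup>L \<nu> h)"
    if "h \<in> borel_measurable (borel_of X)" "\<And>x. x \<in> topspace X \<Longrightarrow> \<bar>h x\<bar> \<le> C" for h :: "'a \<Rightarrow> real" and C
    using integral_bind_pmf_borel_prob[OF \<nu> that, of p] by (simp add: p cong: sum.cong)
  have "measure ?\<gamma> Q = (\<Sum>\<nu>\<in>F. w \<nu> * measure \<nu> Q)" if Q: "Q \<in> sets (borel_of X)" for Q
  proof -
    have "integral\<^sup>L ?\<gamma> (indicator Q) = (\<Sum>\<nu>\<in>F. w \<nu> * integral\<^sup>L \<nu> (indicator Q))"
      using Q by (intro int[of _ 1]) (auto simp: indicator_def)
    moreover have "\<And>\<nu>. \<nu> \<in> F \<Longrightarrow> integral\<^sup>L \<nu> (indicator Q) = measure \<nu> Q"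
      using F A Q integral_indicator_borel_prob by blast
    ultimately show ?thesis
      using integral_indicator_borel_prob[OF \<gamma> Q] by simp
  qed
  then have "?\<gamma> \<in> co X A" using \<gamma> F w by (auto simp: co_def)
  then show ?thesis using int that by blast
qed

lemma return_borel_prob: "x \<in> topspace X \<Longrightarrow> return (borel_of X) x \<in> borel_prob X"
  by (auto simp: borel_prob_def space_borel_of intro: prob_space_return)

text \<open>The discounted occupational measure is the mixture of the point masses along the process with
  geometrically distributed time.\<close>
lemma integral_disc_occ:
  fixes h :: "'a::topological_space \<Rightarrow> real"
  assumes z: "\<And>t. z t \<in> G" and a: "0 < \<alpha>" "\<alpha> < 1"
    and h: "h \<in> borel_measurable (borel_of (top_of_set G))" "\<And>x. x \<in> G \<Longrightarrow> \<bar>h x\<bar> \<le> C"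
  shows "integral\<^sup>L (disc_occ G \<alpha> z) h = (1 - \<alpha>) * (\<Sum>t. \<alpha> ^ t * h (z t))"
proof -
  let ?B = "borel_of (top_of_set G)" and ?p = "geometric_pmf (1 - \<alpha>)"
  have E: "(\<integral>t. g t \<partial>?p) = (1 - \<alpha>) * (\<Sum>t. \<alpha> ^ t * g t)" if g: "\<And>t. \<bar>g t\<bar> \<le> C'" for g :: "nat \<Rightarrow> real" and C'
  proof -
    have C': "0 \<le> C'" using g[of 0] by linarith
    have sm: "summable (\<lambda>t. norm (\<alpha> ^ t * g t))"
      using a g C' by (intro summable_comparison_test[OF _ summable_mult[OF summable_geometric[of \<alpha>], of C']])
        (auto simp: abs_mult mult.commute intro!: mult_left_mono)
    then have sm2: "summable (\<lambda>t. norm ((1 - \<alpha>) * (\<alpha> ^ t * g t)))"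
      using summable_mult[OF sm, of "\<bar>1 - \<alpha>\<bar>"] by (simp add: abs_mult)
    have "(\<integral>t. g t \<partial>?p) = (\<integral>t. (1 - \<alpha>) * (\<alpha> ^ t * g t) \<partial>count_space UNIV)"
      using a unfolding measure_pmf_eq_density
      by (subst integral_density) (auto simp: ac_simps)
    also have "\<dots> = (\<Sum>t. (1 - \<alpha>) * (\<alpha> ^ t * g t))"
      using sm2 by (intro integral_count_space_nat) (simp only: integrable_count_space_nat_iff)
    also have "\<dots> = (1 - \<alpha>) * (\<Sum>t. \<alpha> ^ t * g t)"
      by (rule suminf_mult) (rule summable_norm_cancel[OF sm])
    finally show ?thesis .
  qed
  have \<nu>: "\<And>t. return ?B (z t) \<in> borel_prob (top_of_set G)"
    using z by (intro return_borel_prob) auto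
  have "measure (disc_occ G \<alpha> z) Q = (\<integral>t. measure (return ?B (z t)) Q \<partial>?p)"
    if Q: "Q \<in> sets ?B" for Q
  proof -
    have "0 \<le> (1 - \<alpha>) * (\<Sum>t. \<alpha> ^ t * indicator Q (z t))"
      using a E[of "\<lambda>t. indicator Q (z t)" 1]
      by (metis (no_types, lifting) Bochner_Integration.integral_nonneg abs_indicator indicator_le_1 indicator_pos_le)
    then have "measure (disc_occ G \<alpha> z) Q = (1 - \<alpha>) * (\<Sum>t. \<alpha> ^ t * indicator Q (z t))"
      by (simp add: measure_def emeasure_disc_occ[OF z a Q])
    also have "\<dots> = (\<integral>t. indicator Q (z t) \<partial>?p)"
      by (rule E[symmetric, of _ 1]) (auto simp: indicator_def)
    finally show ?thesis using Q by (simp add: measure_return)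
  qed
  from integral_mixture[OF disc_occ_prob[OF z a] \<nu> this h(1)] h(2)
  have "integral\<^sup>L (disc_occ G \<alpha> z) h = (\<integral>t. integral\<^sup>L (return ?B (z t)) h \<partial>?p)" by auto
  also have "\<dots> = (\<integral>t. h (z t) \<partial>?p)"
    using z h(1) by (subst integral_return) (auto simp: space_borel_of)
  also have "\<dots> = (1 - \<alpha>) * (\<Sum>t. \<alpha> ^ t * h (z t))"
    using z h(2) by (intro E[of _ C]) auto
  finally show ?thesis .
qed

text \<open>Here the time is uniformly distributed on the horizon.\<close>
lemma integral_avg_occ:
  fixes h :: "'a::topological_space \<Rightarrow> real"
  assumes z: "\<And>t. t < S \<Longrightarrow> z t \<in> G" and S: "0 < S"
    and h: "h \<in> borel_measurable (borel_of (top_of_set G))" "\<And>x. x \<in> G \<Longrightarrow> \<bar>h x\<bar> \<le> C"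
  shows "integral\<^sup>L (avg_occ G S z) h = (\<Sum>t<S. h (z t)) / real S"
proof -
  let ?B = "borel_of (top_of_set G)" and ?p = "pmf_of_set {..<S}"
  \<comment> \<open>Beyond the horizon the process may leave \<open>G\<close>; the replaced values have weight 0.\<close>
  let ?z = "\<lambda>t. if t < S then z t else z 0"
  have z': "\<And>t. ?z t \<in> G" using z S by auto
  have E: "(\<integral>t. g (?z t) \<partial>?p) = (\<Sum>t<S. g (z t)) / real S" for g :: "'a \<Rightarrow> real"
    using S by (subst integral_pmf_of_set) (auto simp: lessThan_empty_iff)
  have \<nu>: "\<And>t. return ?B (?z t) \<in> borel_prob (top_of_set G)"
    using z' by (intro return_borel_prob) auto
  have "measure (avg_occ G S z) Q = (\<integral>t. measure (return ?B (?z t)) Q \<partial>?p)"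
    if Q: "Q \<in> sets ?B" for Q
  proof -
    have "measure (avg_occ G S z) Q = 1 / real S * (\<Sum>t<S. indicator Q (z t))"
      by (simp add: measure_def emeasure_avg_occ[OF z S Q] sum_nonneg)
    also have "\<dots> = (\<integral>t. indicator Q (?z t) \<partial>?p)" by (simp add: E)
    finally show ?thesis using Q by (simp add: measure_return)
  qed
  from integral_mixture[OF avg_occ_prob[OF z S] \<nu> this h(1)] h(2)
  have "integral\<^sup>L (avg_occ G S z) h = (\<integral>t. integral\<^sup>L (return ?B (?z t)) h \<partial>?p)" by auto
  also have "\<dots> = (\<integral>t. h (?z t) \<partial>?p)"
    using z' h(1) by (subst integral_return) (auto simp: space_borel_of)
  finally show ?thesis by (simp add: E)
qed

section \<open>Continuous functions and measures on the one-point compactification\<close>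

text \<open>The neighbourhoods of infinity are the complements of closed compact sets, so continuity at
  infinity means that the preimage of the complement of a neighbourhood is compact.\<close>
lemma continuous_map_compactifI:
  assumes cont: "continuous_map (top_of_set G) T (\<lambda>x. h (Some x))"
    and None: "h None \<in> topspace T"
    and proper: "\<And>V. openin T V \<Longrightarrow> h None \<in> V \<Longrightarrow> compact {x \<in> G. h (Some x) \<notin> V}"
  shows "continuous_map (compactif G) T h"
  unfolding continuous_map_def
proof (intro conjI allI impI)
  show "h \<in> topspace (compactif G) \<rightarrow> topspace T"
    using cont None by (auto simp: continuous_map_def)
  fix V assume V: "openin T V"
  let ?U = "{x \<in> G. h (Some x) \<in> V}" and ?C = "{x \<in> G. h (Some x) \<notin> V}"
  have U: "openin (top_of_set G) ?U"
    using cont V by (auto simp: continuous_map_def)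
  show "openin (compactif G) {x \<in> topspace (compactif G). h x \<in> V}"
  proof (cases "h None \<in> V")
    case True
    have "?C = topspace (top_of_set G) - ?U" by auto
    then have "closedin (top_of_set G) ?C" 
      using closedin_diff[OF closedin_topspace U] by simp
    moreover have "compactin (top_of_set G) ?C"
      using proper[OF V True] by (auto simp: compactin_subtopology)
    moreover have "{x \<in> topspace (compactif G). h x \<in> V} = insert None (Some ` (topspace (top_of_set G) - ?C))"
      using True by auto
    ultimately show ?thesis unfolding openin_Alexandroff_compactification by blast
  next
    case False
    then have "{x \<in> topspace (compactif G). h x \<in> V} = Some ` ?U" by auto
    then show ?thesis using U by simp
  qed
qed

text \<open>Proper maps extend to the compactifications, fixing the point at infinity.\<close>
lemma continuous_map_compactif_map_option:
  assumes "continuous_on G g" "g ` G \<subseteq> Y"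
    and proper: "\<And>K. compact K \<Longrightarrow> K \<subseteq> Y \<Longrightarrow> compact {x \<in> G. g x \<in> K}"
  shows "continuous_map (compactif G) (compactif Y) (map_option g)"
proof (rule continuous_map_compactifI)
  have "continuous_map (top_of_set G) (top_of_set Y) g"
    using assms by (auto simp: continuous_map_in_subtopology)
  from continuous_map_compose[OF this continuous_map_Some]
  show "continuous_map (top_of_set G) (compactif Y) (\<lambda>x. map_option g (Some x))"
    by (simp add: comp_def)
  fix V assume "openin (compactif Y) V" and N: "map_option g None \<in> V"
  then obtain C where C: "compactin (top_of_set Y) C" "V = insert None (Some ` (Y - C))"
    by (auto simp: openin_Alexandroff_compactification)
  have "{x \<in> G. map_option g (Some x) \<notin> V} = {x \<in> G. g x \<in> C}"
    using C assms(2) by auto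
  then show "compact {x \<in> G. map_option g (Some x) \<notin> V}"
    using C by (auto simp: compactin_subtopology intro!: proper)
qed simp

lemma continuous_map_compactif_compact_support:
  fixes \<psi> :: "'a::t2_space \<Rightarrow> real"
  assumes Y: "closed Y" and \<psi>: "continuous_on Y \<psi>" and K: "compact K" "\<And>y. y \<in> Y - K \<Longrightarrow> \<psi> y = 0"
  shows "continuous_map (compactif Y) euclideanreal (case_option 0 \<psi>)"
proof (rule continuous_map_compactifI)
  show "continuous_map (top_of_set Y) euclideanreal (\<lambda>x. case Some x of None \<Rightarrow> 0 | Some x \<Rightarrow> \<psi> x)"
    using \<psi> by simp
  fix V :: "real set" assume V: "openin euclidean V" and 0: "(case None of None \<Rightarrow> 0 | Some x \<Rightarrow> \<psi> x) \<in> V"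
  have YK: "compact (Y \<inter> K)" using Y K by (simp add: closed_Int_compact)
  have "closed ((Y \<inter> K) \<inter> \<psi> -` (- V))"
    using V by (intro continuous_closed_preimage continuous_on_subset[OF \<psi>] compact_imp_closed[OF YK]) auto
  then have "compact ((Y \<inter> K) \<inter> ((Y \<inter> K) \<inter> \<psi> -` (- V)))"
    by (rule compact_Int_closed[OF YK])
  moreover have "{x \<in> Y. (case Some x of None \<Rightarrow> 0 | Some x \<Rightarrow> \<psi> x) \<notin> V} = (Y \<inter> K) \<inter> ((Y \<inter> K) \<inter> \<psi> -` (- V))"
    using 0 K(2) by force
  ultimately show "compact {x \<in> Y. (case Some x of None \<Rightarrow> 0 | Some x \<Rightarrow> \<psi> x) \<notin> V}" by simp
qed simp

lemma continuous_map_compactif_bounded: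
  fixes q :: "'a::topological_space option \<Rightarrow> real"
  assumes "continuous_map (compactif G) euclideanreal q"
  obtains C where "\<And>x. x \<in> topspace (compactif G) \<Longrightarrow> \<bar>q x\<bar> \<le> C"
proof -
  have "compactin (compactif G) (topspace (compactif G))"
    using compact_space_Alexandroff_compactification compact_space_def by blast
  then have "compact (q ` topspace (compactif G))"
    using image_compactin[OF _ assms] compactin_euclidean_iff by blast
  then obtain C where "\<forall>x\<in>q ` topspace (compactif G). \<bar>x\<bar> \<le> C"
    using compact_imp_bounded bounded_real by metis
  then show ?thesis using that by blast
qed

lemma continuous_map_compactif_Some:
  "continuous_map (compactif G) T q \<Longrightarrow> continuous_map (top_of_set G) T (\<lambda>x. q (Some x))"
  using continuous_map_compose[OF continuous_map_Some] by (fastforce simp: comp_def)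

lemma integral_ext_measure:
  fixes q :: "'a::topological_space option \<Rightarrow> real"
  assumes "\<gamma> \<in> borel_prob (top_of_set G)" "continuous_map (compactif G) euclideanreal q"
  shows "integral\<^sup>L (ext_measure G \<gamma>) q = (\<integral>x. q (Some x) \<partial>\<gamma>)"
  unfolding ext_measure_def
  using assms Some_measurable continuous_map_borel_of
  by (intro integral_distr) (auto simp: measurable_borel_prob)

text \<open>The inverse of the identification: a measure without mass at infinity is pushed forward along
  the map that sends infinity to an arbitrary point of \<open>G\<close>.\<close>
lemma prob_no_infinity_ext_measure:
  fixes G :: "'a::topological_space set"
  assumes \<gamma>': "\<gamma>' \<in> prob_no_infinity G" and "G \<noteq> {}"
  obtains \<gamma> where "\<gamma> \<in> borel_prob (top_of_set G)" "ext_measure G \<gamma> = \<gamma>'"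
proof -
  let ?B = "borel_of (compactif G)" and ?BG = "borel_of (top_of_set G)"
  obtain z0 where z0: "z0 \<in> G" using assms by blast
  define d where "d = case_option z0 (\<lambda>x::'a. x)"
  have \<gamma>'p: "\<gamma>' \<in> borel_prob (compactif G)" and N: "measure \<gamma>' {None} = 0"
    using \<gamma>' by (auto simp: prob_no_infinity_def)
  interpret \<gamma>': prob_space \<gamma>' by (rule prob_space_borel_prob[OF \<gamma>'p])
  have op: "Some ` Q \<in> sets ?B" if "openin (top_of_set G) Q" for Q
    using that by (auto simp: sets_borel_of)
  have "Some ` G \<in> sets ?B" by (rule op) auto
  then have "space ?B - Some ` G \<in> sets ?B" by blast
  moreover have "space ?B - Some ` G = {None}" by (auto simp: space_borel_of)
  ultimately have N_in: "{None} \<in> sets ?B" by simp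
  have d: "d \<in> measurable ?B ?BG"
  proof (unfold borel_of_def[of "top_of_set G"], rule measurable_measure_of)
    show "{S. openin (top_of_set G) S} \<subseteq> Pow (topspace (top_of_set G))"
      using openin_subset by blast
    show "d \<in> space ?B \<rightarrow> topspace (top_of_set G)"
      using z0 by (auto simp: d_def space_borel_of)
    fix Q assume "Q \<in> {S. openin (top_of_set G) S}"
    then have Q: "openin (top_of_set G) Q" by simp
    then have "Q \<subseteq> G" by (metis openin_imp_subset)
    then have "d -` Q \<inter> space ?B = (if z0 \<in> Q then insert None (Some ` Q) else Some ` Q)"
      by (auto simp: d_def space_borel_of split: option.splits)
    then show "d -` Q \<inter> space ?B \<in> sets ?B"
      using op[OF Q] sets.insert_in_sets[OF N_in] by auto
  qed
  have d': "d \<in> measurable \<gamma>' ?BG" using d by (simp add: measurable_borel_prob[OF \<gamma>'p])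
  define \<gamma> where "\<gamma> = distr \<gamma>' ?BG d"
  have \<gamma>: "\<gamma> \<in> borel_prob (top_of_set G)"
    unfolding borel_prob_def \<gamma>_def using \<gamma>'.prob_space_distr[OF d'] by simp
  have "AE x in \<gamma>'. x \<noteq> None"
    using N_in N by (intro AE_I[of _ _ "{None}"])
      (auto simp: \<gamma>'.emeasure_eq_measure sets_borel_prob[OF \<gamma>'p])
  then have ae: "AE x in \<gamma>'. (Some \<circ> d) x = x"
    by eventually_elim (auto simp: d_def)
  have "ext_measure G \<gamma> = distr \<gamma>' ?B (Some \<circ> d)"
    unfolding ext_measure_def \<gamma>_def by (rule distr_distr[OF Some_measurable d'])
  also have "\<dots> = distr \<gamma>' ?B (\<lambda>x. x)"
    using ae measurable_comp[OF d' Some_measurable]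
    by (intro distr_cong_AE refl) (auto simp: measurable_borel_prob[OF \<gamma>'p])
  also have "\<dots> = \<gamma>'" by (rule distr_id2) (simp add: sets_borel_prob[OF \<gamma>'p])
  finally show ?thesis using that \<gamma> by blast
qed

section \<open>Approximation by convex combinations\<close>

text \<open>A point of a finite-dimensional space that no linear functional separates from a bounded convex
  set lies in its closure. The coordinates range over an arbitrary finite set \<open>N\<close>, so instead of a
  hyperplane separation theorem for a fixed space the infimum \<open>d\<close> of the squared distance is
  examined. From a nearly closest \<open>v\<close>, moving a fraction \<open>t\<close> towards a \<open>v'\<close> that is nearly extremal in
  the direction \<open>p - v\<close> multiplies the squared distance by at most \<open>1 - t\<close>, up to an error of order
  \<open>t\<^sup>2\<close>. Since the result cannot be below \<open>d\<close>, this forces \<open>t d \<le> t\<^sup>2 B\<close> for all small \<open>t\<close>.\<close>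
lemma convex_moment_approximation:
  fixes K :: "('i \<Rightarrow> real) set" and p :: "'i \<Rightarrow> real"
  assumes ne: "K \<noteq> {}"
    and convex: "\<And>v v' t. v \<in> K \<Longrightarrow> v' \<in> K \<Longrightarrow> 0 \<le> t \<Longrightarrow> t \<le> 1 \<Longrightarrow> (\<lambda>i. (1 - t) * v i + t * v' i) \<in> K"
    and bound: "\<And>v. v \<in> K \<Longrightarrow> (\<Sum>i\<in>N. (v i - p i)\<^sup>2) \<le> B"
    and support: "\<And>l e. 0 < e \<Longrightarrow> \<exists>v\<in>K. (\<Sum>i\<in>N. l i * p i) - e \<le> (\<Sum>i\<in>N. l i * v i)"
    and e: "0 < e"
  shows "\<exists>v\<in>K. (\<Sum>i\<in>N. (v i - p i)\<^sup>2) < e"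
proof -
  let ?D = "\<lambda>v. \<Sum>i\<in>N. (v i - p i)\<^sup>2"
  have D0: "0 \<le> ?D v" for v by (rule sum_nonneg) simp
  define d where "d = Inf (?D ` K)"
  have bdd: "bdd_below (?D ` K)" using D0 by (intro bdd_belowI2)
  have d_le: "d \<le> ?D v" if "v \<in> K" for v
    unfolding d_def using bdd that by (rule cINF_lower)
  have step: "t * d \<le> t * (t * B)" if t: "0 < t" "t < 1" for t
  proof (rule field_le_epsilon)
    fix s :: real assume s: "0 < s"
    define h where "h = s / 3"
    have h: "0 < h" using s by (simp add: h_def)
    have "Inf (?D ` K) < d + h" using h by (simp add: d_def)
    then obtain v where v: "v \<in> K" "?D v < d + h"
      using cInf_lessD[of "?D ` K"] ne by blast
    obtain v' where v': "v' \<in> K"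
      "(\<Sum>i\<in>N. (p i - v i) * p i) - h \<le> (\<Sum>i\<in>N. (p i - v i) * v' i)"
      using support[OF h, of "\<lambda>i. p i - v i"] by blast
    let ?X = "\<Sum>i\<in>N. (v i - p i) * (v' i - p i)"
    have "?X = (\<Sum>i\<in>N. (p i - v i) * p i) - (\<Sum>i\<in>N. (p i - v i) * v' i)"
      unfolding sum_subtractf[symmetric] by (rule sum.cong) (auto simp: algebra_simps)
    then have X: "?X \<le> h" using v'(2) by linarith
    have "?D (\<lambda>i. (1 - t) * v i + t * v' i) = (\<Sum>i\<in>N. (1 - t)\<^sup>2 * (v i - p i)\<^sup>2
        + 2 * t * (1 - t) * ((v i - p i) * (v' i - p i)) + t\<^sup>2 * (v' i - p i)\<^sup>2)"
      by (rule sum.cong) (auto simp: power2_eq_square algebra_simps)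
    also have "\<dots> = (1 - t)\<^sup>2 * ?D v + 2 * t * (1 - t) * ?X + t\<^sup>2 * ?D v'"
      by (simp add: sum.distrib sum_distrib_left)
    also have "\<dots> \<le> (1 - t) * (d + h) + 2 * h + t\<^sup>2 * B"
    proof (intro add_mono mult_left_mono bound v'(1))
      have "(1 - t)\<^sup>2 * ?D v \<le> (1 - t) * ?D v"
        using t D0 by (intro mult_right_mono) (auto simp: power2_eq_square mult_left_le)
      also have "\<dots> \<le> (1 - t) * (d + h)" using t v(2) by (intro mult_left_mono) auto
      finally show "(1 - t)\<^sup>2 * ?D v \<le> (1 - t) * (d + h)" .
      have "t * (1 - t) * ?X \<le> t * (1 - t) * h" using t X by (intro mult_left_mono) auto
      also have "\<dots> \<le> 1 * h" using t h by (intro mult_right_mono) (auto simp: mult_le_one)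
      finally show "2 * t * (1 - t) * ?X \<le> 2 * h" by (simp add: mult.assoc)
    qed simp
    finally have "d \<le> (1 - t) * (d + h) + 2 * h + t\<^sup>2 * B"
      using d_le[OF convex[OF v(1) v'(1), of t]] t by simp
    moreover have "(1 - t) * h \<le> 1 * h" using t h by (intro mult_right_mono) auto
    moreover have "(1 - t) * (d + h) = d - t * d + (1 - t) * h" "t\<^sup>2 * B = t * (t * B)"
      by (simp_all add: algebra_simps power2_eq_square)
    ultimately show "t * d \<le> t * (t * B) + s" using h_def by linarith
  qed
  have "d \<le> 0"
  proof (rule field_le_epsilon)
    fix s :: real assume s: "0 < s"
    \<comment> \<open>Chosen such that \<open>t * B \<le> s\<close>.\<close>
    define t where "t = min (1 / 2) (s / (\<bar>B\<bar> + 1))"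
    have t: "0 < t" "t < 1" using s by (auto simp: t_def)
    have "t * B \<le> s / (\<bar>B\<bar> + 1) * (\<bar>B\<bar> + 1)"
      using t by (intro order_trans[OF mult_left_mono mult_right_mono]) (auto simp: t_def)
    then show "d \<le> 0 + s" using step[OF t] t by simp
  qed
  then have "Inf (?D ` K) < e" using e by (simp add: d_def)
  then show ?thesis using cInf_lessD[of "?D ` K" e] ne by blast
qed

lemma sum_extend_weights:
  fixes w g :: "'i \<Rightarrow> real"
  assumes "finite F" "F' \<subseteq> F"
  shows "(\<Sum>\<nu>\<in>F. (if \<nu> \<in> F' then w \<nu> else 0) * g \<nu>) = (\<Sum>\<nu>\<in>F'. w \<nu> * g \<nu>)"
  using assms by (intro sum.mono_neutral_cong_right) auto

text \<open>The duality principle for measures: if no finite combination of the test functions \<open>h\<^sub>i\<close>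
  separates \<open>\<gamma>\<close> from \<open>A\<close>, then the convex hull of \<open>A\<close> contains measures whose integrals of the
  \<open>h\<^sub>i\<close> are arbitrarily close to those of \<open>\<gamma>\<close>.\<close>
lemma co_moment_approximation:
  fixes A :: "'a measure set" and h :: "'i \<Rightarrow> 'a \<Rightarrow> real"
  assumes A: "A \<subseteq> borel_prob X" and \<gamma>: "\<gamma> \<in> borel_prob X" and N: "finite N" and e: "0 < e"
    and h: "\<And>i. h i \<in> borel_measurable (borel_of X)" "\<And>i x. x \<in> topspace X \<Longrightarrow> \<bar>h i x\<bar> \<le> C i"
    and support: "\<And>l e. 0 < e \<Longrightarrow> \<exists>\<nu>\<in>A. (\<integral>x. (\<Sum>i\<in>N. l i * h i x) \<partial>\<gamma>) - e \<le> (\<integral>x. (\<Sum>i\<in>N. l i * h i x) \<partial>\<nu>)"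
  shows "\<exists>\<nu>\<in>co X A. (\<Sum>i\<in>N. (integral\<^sup>L \<nu> (h i) - integral\<^sup>L \<gamma> (h i))\<^sup>2) < e"
proof -
  define comb where "comb v F w \<longleftrightarrow> finite F \<and> F \<subseteq> A \<and> (\<forall>\<nu>\<in>F. 0 \<le> w \<nu>) \<and> sum w F = 1 \<and>
    v = (\<lambda>i. \<Sum>\<nu>\<in>F. w \<nu> * integral\<^sup>L \<nu> (h i))" for v :: "'i \<Rightarrow> real" and F w
  define K where "K = {v. \<exists>F w. comb v F w}"
  have K_co: "\<exists>\<nu>\<in>co X A. v = (\<lambda>i. integral\<^sup>L \<nu> (h i))" if "v \<in> K" for v
  proof -
    obtain F w where "comb v F w" using \<open>v \<in> K\<close> by (auto simp: K_def)
    then have F: "finite F" "F \<subseteq> A" "\<forall>\<nu>\<in>F. 0 \<le> w \<nu>" "sum w F = 1"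
      and v: "v = (\<lambda>i. \<Sum>\<nu>\<in>F. w \<nu> * integral\<^sup>L \<nu> (h i))" by (simp_all add: comb_def)
    obtain \<nu> where \<nu>: "\<nu> \<in> co X A" "\<And>(g :: 'a \<Rightarrow> real) B. g \<in> borel_measurable (borel_of X) \<Longrightarrow>
        (\<And>x. x \<in> topspace X \<Longrightarrow> \<bar>g x\<bar> \<le> B) \<Longrightarrow> integral\<^sup>L \<nu> g = (\<Sum>\<nu>\<in>F. w \<nu> * integral\<^sup>L \<nu> g)"
      by (rule convex_combination_in_co[OF F(1,2) A F(3,4)]) blast
    have "v = (\<lambda>i. integral\<^sup>L \<nu> (h i))"
      unfolding v using \<nu>(2)[OF h(1) h(2)] by simp
    then show ?thesis using \<nu>(1) by blast
  qed
  have single: "(\<lambda>i. integral\<^sup>L \<nu> (h i)) \<in> K" if "\<nu> \<in> A" for \<nu>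
    unfolding K_def comb_def using that by (intro CollectI exI[of _ "{\<nu>}"] exI[of _ "\<lambda>_. 1"]) auto
  have int: "(\<integral>x. (\<Sum>i\<in>N. l i * h i x) \<partial>\<nu>) = (\<Sum>i\<in>N. l i * integral\<^sup>L \<nu> (h i))"
    if "\<nu> \<in> borel_prob X" for \<nu> l
    using integrable_borel_prob[OF that h(1) h(2)] by (subst Bochner_Integration.integral_sum) auto
  have "\<exists>v\<in>K. (\<Sum>i\<in>N. (v i - integral\<^sup>L \<gamma> (h i))\<^sup>2) < e"
  proof (rule convex_moment_approximation[where B = "\<Sum>i\<in>N. (2 * C i)\<^sup>2", OF _ _ _ _ e])
    have "\<exists>\<nu>. \<nu> \<in> A" using support[of 1] by auto
    then show "K \<noteq> {}" using single by blast
    show "(\<Sum>i\<in>N. (v i - integral\<^sup>L \<gamma> (h i))\<^sup>2) \<le> (\<Sum>i\<in>N. (2 * C i)\<^sup>2)" if "v \<in> K" for v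
    proof (rule sum_mono)
      fix i
      obtain \<nu> where \<nu>: "\<nu> \<in> co X A" "v = (\<lambda>i. integral\<^sup>L \<nu> (h i))" using K_co[OF \<open>v \<in> K\<close>] by blast
      then have "\<nu> \<in> borel_prob X" by (simp add: co_def)
      from abs_integral_borel_prob_le[OF this h(1) h(2), of i] abs_integral_borel_prob_le[OF \<gamma> h(1) h(2), of i]
      have "\<bar>v i - integral\<^sup>L \<gamma> (h i)\<bar> \<le> \<bar>2 * C i\<bar>" unfolding \<nu>(2) by auto
      then show "(v i - integral\<^sup>L \<gamma> (h i))\<^sup>2 \<le> (2 * C i)\<^sup>2" by (simp only: abs_le_square_iff)
    qed
    show "\<exists>v\<in>K. (\<Sum>i\<in>N. l i * integral\<^sup>L \<gamma> (h i)) - e \<le> (\<Sum>i\<in>N. l i * v i)" if "0 < e" for l e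
    proof -
      obtain \<nu> where "\<nu> \<in> A" "(\<integral>x. (\<Sum>i\<in>N. l i * h i x) \<partial>\<gamma>) - e \<le> (\<integral>x. (\<Sum>i\<in>N. l i * h i x) \<partial>\<nu>)"
        using support[OF \<open>0 < e\<close>, of l] by blast
      then show ?thesis
        using single[of \<nu>] int[OF \<gamma>] int[of \<nu>] A
        by (intro bexI[of _ "\<lambda>i. integral\<^sup>L \<nu> (h i)"]) auto
    qed
    show "(\<lambda>i. (1 - t) * v i + t * v' i) \<in> K" if v: "v \<in> K" "v' \<in> K" and t: "0 \<le> t" "t \<le> 1" for v v' t
    proof -
      obtain F w F' w' where "comb v F w" "comb v' F' w'" using v by (auto simp: K_def)
      then have F: "finite F" "F \<subseteq> A" "\<forall>\<nu>\<in>F. 0 \<le> w \<nu>" "sum w F = 1"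
        and F': "finite F'" "F' \<subseteq> A" "\<forall>\<nu>\<in>F'. 0 \<le> w' \<nu>" "sum w' F' = 1"
        and v_eq: "v = (\<lambda>i. \<Sum>\<nu>\<in>F. w \<nu> * integral\<^sup>L \<nu> (h i))" "v' = (\<lambda>i. \<Sum>\<nu>\<in>F'. w' \<nu> * integral\<^sup>L \<nu> (h i))"
        by (simp_all add: comb_def)
      \<comment> \<open>The two families of measures may overlap, in which case their weights add up.\<close>
      let ?w = "\<lambda>\<nu>. (1 - t) * (if \<nu> \<in> F then w \<nu> else 0) + t * (if \<nu> \<in> F' then w' \<nu> else 0)"
      have sums: "(\<Sum>\<nu>\<in>F \<union> F'. ?w \<nu> * g \<nu>) = (1 - t) * (\<Sum>\<nu>\<in>F. w \<nu> * g \<nu>) + t * (\<Sum>\<nu>\<in>F'. w' \<nu> * g \<nu>)" for g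
      proof -
        have "(\<Sum>\<nu>\<in>F \<union> F'. ?w \<nu> * g \<nu>) = (1 - t) * (\<Sum>\<nu>\<in>F \<union> F'. (if \<nu> \<in> F then w \<nu> else 0) * g \<nu>)
            + t * (\<Sum>\<nu>\<in>F \<union> F'. (if \<nu> \<in> F' then w' \<nu> else 0) * g \<nu>)"
          unfolding sum_distrib_left sum.distrib[symmetric] by (rule sum.cong) (simp_all add: algebra_simps)
        also have "(\<Sum>\<nu>\<in>F \<union> F'. (if \<nu> \<in> F then w \<nu> else 0) * g \<nu>) = (\<Sum>\<nu>\<in>F. w \<nu> * g \<nu>)"
          using F(1) F'(1) by (intro sum_extend_weights) auto
        also have "(\<Sum>\<nu>\<in>F \<union> F'. (if \<nu> \<in> F' then w' \<nu> else 0) * g \<nu>) = (\<Sum>\<nu>\<in>F'. w' \<nu> * g \<nu>)"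
          using F(1) F'(1) by (intro sum_extend_weights) auto
        finally show ?thesis .
      qed
      have "sum ?w (F \<union> F') = 1" using sums[of "\<lambda>_. 1"] F(4) F'(4) by simp
      moreover have "\<forall>\<nu>\<in>F \<union> F'. 0 \<le> ?w \<nu>" using F(3) F'(3) t by simp
      ultimately have "comb (\<lambda>i. (1 - t) * v i + t * v' i) (F \<union> F') ?w"
        unfolding comb_def sums v_eq using F(1,2) F'(1,2) by blast
      then show ?thesis unfolding K_def by blast
    qed
  qed
  then show ?thesis using K_co by fastforce
qed

section \<open>A countable class of functions that determines weak convergence\<close>

text \<open>The parameters are the height, the slope and the position of the apex of a cone. Restricting them
  to countable types is what makes the class of these functions countable.\<close>
definition cone_max :: "(nat \<Rightarrow> 'a::metric_space) \<Rightarrow> (rat \<times> nat \<times> nat) list \<Rightarrow> 'a \<Rightarrow> real" where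
  "cone_max d L z = foldr (\<lambda>(r, c, j) m. max (of_rat r - real c * dist z (d j)) m) L 0"

lemma cone_max_simps [simp]:
  "cone_max d [] z = 0"
  "cone_max d ((r, c, j) # L) z = max (of_rat r - real c * dist z (d j)) (cone_max d L z)"
  by (simp_all add: cone_max_def)

lemma cone_max_nonneg: "0 \<le> cone_max d L z"
  by (induction L) auto

lemma continuous_on_cone_max: "continuous_on A (cone_max d L)"
proof (induction L)
  case (Cons x L)
  obtain r c j where x: "x = (r, c, j)" by (cases x)
  have "continuous_on A (\<lambda>z. max (of_rat r - real c * dist z (d j)) (cone_max d L z))"
    by (intro continuous_intros Cons.IH)
  then show ?case by (simp add: x)
qed simp

lemma cone_max_bounded: "\<exists>C. \<forall>z. \<bar>cone_max d L z\<bar> \<le> C"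
proof (induction L)
  case (Cons x L)
  then obtain C where C: "\<And>z. \<bar>cone_max d L z\<bar> \<le> C" by blast
  obtain r c j where x: "x = (r, c, j)" by (cases x)
  have "\<bar>cone_max d (x # L) z\<bar> \<le> max (of_rat r) C" for z
  proof -
    have "cone_max d (x # L) z \<le> max (of_rat r) C"
      unfolding x cone_max_simps by (rule max.mono) (use C[of z] in auto)
    then show ?thesis using cone_max_nonneg[of d "x # L" z] by linarith
  qed
  then show ?case by blast
qed (auto intro: exI[of _ 0])

lemma cone_max_le:
  "0 \<le> b \<Longrightarrow> (\<And>r c j. (r, c, j) \<in> set L \<Longrightarrow> of_rat r - real c * dist z (d j) \<le> b) \<Longrightarrow> cone_max d L z \<le> b"
  by (induction L) auto

lemma cone_max_ge:
  "(r, c, j) \<in> set L \<Longrightarrow> of_rat r - real c * dist z (d j) \<le> cone_max d L z"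
  by (induction L) (auto simp: le_max_iff_disj)

text \<open>Choose a rational height \<open>r\<close> between \<open>s\<close> and \<open>q z\<close>, then a slope so steep that the cone is
  negative outside a ball around \<open>z\<close> on which \<open>q\<close> exceeds \<open>r\<close>, and only then an apex so close to \<open>z\<close> that
  the steep cone has lost less than \<open>r - s\<close> at \<open>z\<close>.\<close>
lemma exists_cone_below:
  fixes q :: "'a::metric_space \<Rightarrow> real"
  assumes dense: "\<And>z e. z \<in> G \<Longrightarrow> 0 < e \<Longrightarrow> \<exists>j::nat. dist z (d j) < e"
    and q: "continuous_on G q" "\<And>z. z \<in> G \<Longrightarrow> 0 \<le> q z"
    and z: "z \<in> G" "s < q z"
  obtains r c j where "\<And>x. x \<in> G \<Longrightarrow> of_rat r - real c * dist x (d j) \<le> q x"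
    "s < of_rat r - real c * dist z (d j)"
proof -
  obtain r where r: "s < of_rat r" "of_rat r < q z" using of_rat_dense[OF z(2)] by blast
  obtain \<delta> where \<delta>: "\<delta> > 0" "\<And>x. x \<in> G \<Longrightarrow> dist x z < \<delta> \<Longrightarrow> dist (q x) (q z) < q z - of_rat r"
    using q(1)[unfolded continuous_on_iff, rule_format, OF z(1), of "q z - of_rat r"] r(2) by auto
  obtain c :: nat where c: "of_rat r / (\<delta> / 2) < real c" using reals_Archimedean2 by blast
  obtain j where j: "dist z (d j) < min (\<delta> / 2) ((of_rat r - s) / (real c + 1))"
    using dense[OF z(1), of "min (\<delta> / 2) ((of_rat r - s) / (real c + 1))"] \<delta>(1) r(1) by auto
  have "of_rat r - real c * dist x (d j) \<le> q x" if x: "x \<in> G" for x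
  proof (cases "dist x z < \<delta>")
    case True
    then have "of_rat r < q x" using \<delta>(2)[OF x] by (simp add: dist_real_def)
    moreover have "0 \<le> real c * dist x (d j)" by simp
    ultimately show ?thesis by linarith
  next
    case False
    then have "\<delta> / 2 \<le> dist x (d j)" using j dist_triangle[of x z "d j"] by (simp add: dist_commute)
    then have "real c * (\<delta> / 2) \<le> real c * dist x (d j)" by (intro mult_left_mono) auto
    moreover have "of_rat r < real c * (\<delta> / 2)" using c \<delta>(1) by (subst (asm) pos_divide_less_eq) auto
    ultimately show ?thesis using q(2)[OF x] by linarith
  qed
  moreover have "s < of_rat r - real c * dist z (d j)"
  proof -
    have "dist z (d j) * (real c + 1) < of_rat r - s"
      using j by (simp add: pos_less_divide_eq)
    moreover have "dist z (d j) * (real c + 1) = real c * dist z (d j) + dist z (d j)"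
      by (simp add: algebra_simps)
    ultimately show ?thesis using zero_le_dist[of z "d j"] by linarith
  qed
  ultimately show ?thesis by (rule that)
qed

text \<open>For \<open>L n\<close> take those of the first \<open>n\<close> cones, in a fixed enumeration of all cones, that lie
  below \<open>q\<close>.\<close>
lemma cone_max_converges_to:
  fixes q :: "'a::metric_space \<Rightarrow> real"
  assumes dense: "\<And>z e. z \<in> G \<Longrightarrow> 0 < e \<Longrightarrow> \<exists>j::nat. dist z (d j) < e"
    and q: "continuous_on G q" "\<And>z. z \<in> G \<Longrightarrow> 0 \<le> q z"
  obtains L where "\<And>n z. z \<in> G \<Longrightarrow> cone_max d (L n) z \<le> q z"
    "\<And>z. z \<in> G \<Longrightarrow> (\<lambda>n. cone_max d (L n) z) \<longlonglongrightarrow> q z"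
proof -
  let ?P = "\<lambda>(r, c, j). \<forall>x\<in>G. of_rat r - real c * dist x (d j) \<le> q x"
  define L where "L n = filter ?P (map from_nat [0..<n])" for n
  have le: "cone_max d (L n) z \<le> q z" if "z \<in> G" for n z
    using that q(2) by (intro cone_max_le) (auto simp: L_def)
  moreover have "(\<lambda>n. cone_max d (L n) z) \<longlonglongrightarrow> q z" if z: "z \<in> G" for z
  proof (rule order_tendstoI)
    fix s assume "s < q z"
    then obtain r c j where rcj: "\<And>x. x \<in> G \<Longrightarrow> of_rat r - real c * dist x (d j) \<le> q x"
      "s < of_rat r - real c * dist z (d j)"
      using exists_cone_below[OF dense q z] by metis
    have "s < cone_max d (L n) z" if n: "n > to_nat (r, c, j)" for n
    proof -
      have "(r, c, j) \<in> set (L n)"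
        using n rcj(1) by (auto simp: L_def intro!: image_eqI[of _ _ "to_nat (r, c, j)"])
      from cone_max_ge[OF this, of z d] show ?thesis using rcj(2) by linarith
    qed
    then show "\<forall>\<^sub>F n in sequentially. s < cone_max d (L n) z"
      using eventually_gt_at_top[of "to_nat (r, c, j)"] by (rule eventually_mono[rotated]) auto
  next
    fix s assume "q z < s"
    then show "\<forall>\<^sub>F n in sequentially. cone_max d (L n) z < s"
      using le[OF z] by (intro always_eventually allI) (meson le_less_trans)
  qed
  ultimately show ?thesis by (rule that)
qed

text \<open>Approximation from below by cone maxima gives \<open>\<integral>h d\<gamma> \<le> liminf \<integral>h d\<mu>\<^sub>k\<close> for nonnegative bounded
  continuous \<open>h\<close>. Since all measures are probabilities, applying this to \<open>q + C\<close> and to \<open>C - q\<close>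
  yields both halves of the convergence.\<close>
lemma cone_max_convergence_determining:
  fixes q :: "'a::metric_space \<Rightarrow> real"
  assumes dense: "\<And>z e. z \<in> G \<Longrightarrow> 0 < e \<Longrightarrow> \<exists>j::nat. dist z (d j) < e"
    and \<mu>: "\<And>k. \<mu> k \<in> borel_prob (top_of_set G)" and \<gamma>: "\<gamma> \<in> borel_prob (top_of_set G)"
    and conv: "\<And>L. (\<lambda>k. integral\<^sup>L (\<mu> k) (cone_max d L)) \<longlonglongrightarrow> integral\<^sup>L \<gamma> (cone_max d L)"
    and q: "continuous_on G q" "\<And>z. z \<in> G \<Longrightarrow> \<bar>q z\<bar> \<le> C"
  shows "(\<lambda>k. integral\<^sup>L (\<mu> k) q) \<longlonglongrightarrow> integral\<^sup>L \<gamma> q"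
proof -
  have meas: "h \<in> borel_measurable (borel_of (top_of_set G))" if "continuous_on G h" for h :: "'a \<Rightarrow> real"
    using that by (intro continuous_map_borel_of) simp
  have int: "integrable \<nu> h" if "\<nu> \<in> borel_prob (top_of_set G)" "continuous_on G h" "\<And>z. z \<in> G \<Longrightarrow> \<bar>h z\<bar> \<le> B" for \<nu> and h :: "'a \<Rightarrow> real" and B
    using that by (intro integrable_borel_prob[OF that(1) meas[OF that(2)]]) auto
  have lower: "\<forall>\<^sub>F k in sequentially. s < integral\<^sup>L (\<mu> k) h"
    if h: "continuous_on G h" "\<And>z. z \<in> G \<Longrightarrow> 0 \<le> h z" "\<And>z. z \<in> G \<Longrightarrow> \<bar>h z\<bar> \<le> B"
      and s: "s < integral\<^sup>L \<gamma> h" for h :: "'a \<Rightarrow> real" and s B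
  proof -
    obtain L where L: "\<And>n z. z \<in> G \<Longrightarrow> cone_max d (L n) z \<le> h z"
      "\<And>z. z \<in> G \<Longrightarrow> (\<lambda>n. cone_max d (L n) z) \<longlonglongrightarrow> h z"
      using cone_max_converges_to[OF dense h(1,2)] by metis
    have "(\<lambda>n. integral\<^sup>L \<gamma> (cone_max d (L n))) \<longlonglongrightarrow> integral\<^sup>L \<gamma> h"
    proof (rule integral_dominated_convergence[where w = h])
      show "h \<in> borel_measurable \<gamma>" "\<And>n. cone_max d (L n) \<in> borel_measurable \<gamma>"
        using meas h(1) continuous_on_cone_max by (auto simp: measurable_borel_prob[OF \<gamma>])
      show "integrable \<gamma> h" by (rule int[OF \<gamma> h(1,3)])
    qed (use L in \<open>auto simp: space_borel_prob[OF \<gamma>] abs_of_nonneg[OF cone_max_nonneg] intro!: AE_I2\<close>)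
    from order_tendstoD(1)[OF this s] obtain n where n: "s < integral\<^sup>L \<gamma> (cone_max d (L n))"
      by (auto simp: eventually_sequentially)
    from order_tendstoD(1)[OF conv n] show ?thesis
    proof eventually_elim
      case (elim k)
      obtain B' where "\<And>z. \<bar>cone_max d (L n) z\<bar> \<le> B'" using cone_max_bounded by blast
      then have "integral\<^sup>L (\<mu> k) (cone_max d (L n)) \<le> integral\<^sup>L (\<mu> k) h"
        using L(1) by (intro integral_mono int[OF \<mu> continuous_on_cone_max] int[OF \<mu> h(1,3)])
          (auto simp: space_borel_prob[OF \<mu>])
      then show ?case using elim by linarith
    qed
  qed
  have shift: "integral\<^sup>L \<nu> (\<lambda>z. q z + C) = integral\<^sup>L \<nu> q + C" "integral\<^sup>L \<nu> (\<lambda>z. C - q z) = C - integral\<^sup>L \<nu> q"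
    if "\<nu> \<in> borel_prob (top_of_set G)" for \<nu>
  proof -
    interpret prob_space \<nu> by (rule prob_space_borel_prob[OF that])
    show "integral\<^sup>L \<nu> (\<lambda>z. q z + C) = integral\<^sup>L \<nu> q + C" "integral\<^sup>L \<nu> (\<lambda>z. C - q z) = C - integral\<^sup>L \<nu> q"
      using int[OF that q] by (simp_all add: prob_space)
  qed
  have q': "0 \<le> q z + C" "\<bar>q z + C\<bar> \<le> 2 * C" "0 \<le> C - q z" "\<bar>C - q z\<bar> \<le> 2 * C" if "z \<in> G" for z
    using q(2)[OF that] by auto
  show ?thesis
  proof (rule order_tendstoI)
    fix s assume "s < integral\<^sup>L \<gamma> q"
    then have "\<forall>\<^sub>F k in sequentially. s + C < integral\<^sup>L (\<mu> k) (\<lambda>z. q z + C)"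
      using q' by (intro lower[where B = "2 * C"] continuous_intros q(1)) (auto simp: shift \<gamma>)
    then show "\<forall>\<^sub>F k in sequentially. s < integral\<^sup>L (\<mu> k) q" by (simp add: shift \<mu>)
  next
    fix s assume "integral\<^sup>L \<gamma> q < s"
    then have "\<forall>\<^sub>F k in sequentially. C - s < integral\<^sup>L (\<mu> k) (\<lambda>z. C - q z)"
      using q' by (intro lower[where B = "2 * C"] continuous_intros q(1)) (auto simp: shift \<gamma>)
    then show "\<forall>\<^sub>F k in sequentially. integral\<^sup>L (\<mu> k) q < s" by (simp add: shift \<mu>)
  qed
qed

lemma compact_countable_dense:
  fixes K :: "'a::metric_space set"
  assumes "compact K"
  obtains D where "countable D" "\<And>x e. x \<in> K \<Longrightarrow> 0 < e \<Longrightarrow> \<exists>y\<in>D. dist x y < e"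
proof -
  have "\<exists>k. finite k \<and> K \<subseteq> (\<Union>x\<in>k. ball x (1 / real (Suc n)))" for n
    using assms by (auto simp: compact_eq_totally_bounded)
  then obtain k where k: "\<And>n. finite (k n)" "\<And>n. K \<subseteq> (\<Union>x\<in>k n. ball x (1 / real (Suc n)))" by metis
  show ?thesis
  proof
    show "countable (\<Union>n. k n)" using k(1) by (intro countable_UN) (auto intro: countable_finite)
    fix x e assume x: "x \<in> K" and "(0::real) < e"
    then obtain n where n: "1 / real (Suc n) < e" using nat_approx_posE by blast
    obtain y where "y \<in> k n" "x \<in> ball y (1 / real (Suc n))" using k(2)[of n] x by blast
    then show "\<exists>y\<in>(\<Union>n. k n). dist x y < e" using n by (force simp: dist_commute)
  qed
qed

lemma dense_sequence_Times:
  fixes K :: "'b::metric_space set"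
  assumes "compact K"
  obtains d :: "nat \<Rightarrow> 'a::euclidean_space \<times> 'b"
  where "\<And>z e. z \<in> UNIV \<times> K \<Longrightarrow> 0 < e \<Longrightarrow> \<exists>j. dist z (d j) < e"
proof (cases "K = {}")
  case False
  obtain D2 where D2: "countable D2" "\<And>x e. x \<in> K \<Longrightarrow> 0 < e \<Longrightarrow> \<exists>y\<in>D2. dist x y < e"
    using compact_countable_dense[OF assms] by blast
  obtain D1 :: "'a set" where D1: "countable D1" "\<And>X. open X \<Longrightarrow> X \<noteq> {} \<Longrightarrow> \<exists>x\<in>D1. x \<in> X"
    using countable_dense_setE by blast
  have D1': "\<exists>y\<in>D1. dist x y < e" if "0 < e" for x e
    using D1(2)[of "ball x e"] that by auto
  have ne: "D1 \<times> D2 \<noteq> {}" using D1'[of 1] D2(2)[of _ 1] False by fastforce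
  have cnt: "countable (D1 \<times> D2)" using D1 D2 by simp
  show ?thesis
  proof
    fix z :: "'a \<times> 'b" and e :: real assume z: "z \<in> UNIV \<times> K" and e: "0 < e"
    obtain x where x: "x \<in> D1" "dist (fst z) x < e / 2" using D1' e half_gt_zero by blast
    obtain y where y: "y \<in> D2" "dist (snd z) y < e / 2" using D2(2)[of "snd z" "e / 2"] z e by auto
    have "dist z (x, y) \<le> dist (fst z) x + dist (snd z) y"
      using sqrt_sum_squares_le_sum[of "dist (fst z) x" "dist (snd z) y"] by (cases z) (simp add: dist_Pair_Pair)
    then have "dist z (x, y) < e" using x y by linarith
    moreover obtain j where "from_nat_into (D1 \<times> D2) j = (x, y)"
      using from_nat_into_surj[OF cnt, of "(x, y)"] x y by auto
    ultimately show "\<exists>j. dist z (from_nat_into (D1 \<times> D2) j) < e" by metis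
  qed
qed (use that in auto)

section \<open>The control system and its graph\<close>

locale control_system =
  fixes Y :: "'a::euclidean_space set" and U0 :: "'u::metric_space set"
    and U :: "'a \<Rightarrow> 'u set" and f :: "'a \<times> 'u \<Rightarrow> 'a"
  assumes Y_nonempty: "Y \<noteq> {}" and closed_Y: "closed Y"
    and compact_U0: "compact U0"
    and U_subset: "\<And>y. y \<in> Y \<Longrightarrow> U y \<subseteq> U0"
    and compact_U: "\<And>y. y \<in> Y \<Longrightarrow> compact (U y)"
    and usc_U: "usc_on Y U"
    and continuous_f: "continuous_on (UNIV \<times> U0) f"
    and f_at_infinity: "\<And>M. \<forall>\<^sub>F y in at_infinity. \<forall>u\<in>U0. M \<le> norm (f (y, u))"
    and viable: "\<And>y. y \<in> Y \<Longrightarrow> controls Y U f y \<noteq> {}"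
begin

abbreviation G :: "('a \<times> 'u) set" where "G \<equiv> graph_G Y U f"

lemma in_G_iff: "(y, u) \<in> G \<longleftrightarrow> y \<in> Y \<and> u \<in> U y \<and> f (y, u) \<in> Y"
  by (simp add: graph_G_def)

lemma G_fst: "z \<in> G \<Longrightarrow> fst z \<in> Y" and G_f: "z \<in> G \<Longrightarrow> f z \<in> Y"
  by (auto simp: graph_G_def)

lemma G_subset: "G \<subseteq> UNIV \<times> U0"
  using U_subset by (auto simp: graph_G_def)

lemma continuous_on_G_f: "continuous_on G f"
  by (rule continuous_on_subset[OF continuous_f G_subset])

lemma trajectory_cons:
  "trajectory f y (case_nat v u) (Suc t) = trajectory f (f (y, v)) u t"
  by (induction t) auto

lemma process_cons:
  "process f y (case_nat v u) 0 = (y, v)"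
  "process f y (case_nat v u) (Suc t) = process f (f (y, v)) u t"
  unfolding process_def trajectory_cons by simp_all

lemma controls_process: "u \<in> controls Y U f y \<Longrightarrow> process f y u t \<in> G"
  unfolding controls_def process_def in_G_iff by (auto simp flip: trajectory.simps(2))

lemma exists_G_fiber: assumes "y \<in> Y" obtains u where "(y, u) \<in> G"
proof -
  obtain u where "u \<in> controls Y U f y" using viable[OF assms] by blast
  from controls_process[OF this, of 0] show ?thesis using that by (auto simp: process_def)
qed

lemma G_nonempty: "G \<noteq> {}"
  using Y_nonempty exists_G_fiber by blast

text \<open>An upper semicontinuous map with compact values has a closed graph: a control outside \<open>U y\<close> has a
  closed ball around it that avoids \<open>U y\<close>, hence also \<open>U y'\<close> for all \<open>y'\<close> near \<open>y\<close>.\<close>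
lemma closed_G: "closed G"
  unfolding closed_sequential_limits
proof (intro allI impI, elim conjE)
  fix x :: "nat \<Rightarrow> 'a \<times> 'u" and l
  assume x: "\<forall>n. x n \<in> G" and lim: "x \<longlonglongrightarrow> l"
  obtain y u where l: "l = (y, u)" by fastforce
  have l1: "(\<lambda>n. fst (x n)) \<longlonglongrightarrow> y" and l2: "(\<lambda>n. snd (x n)) \<longlonglongrightarrow> u"
    using tendsto_fst[OF lim] tendsto_snd[OF lim] l by auto
  have xY: "fst (x n) \<in> Y" and xU: "snd (x n) \<in> U (fst (x n))" for n
    using x in_G_iff[of "fst (x n)" "snd (x n)"] by auto
  have y: "y \<in> Y" by (rule closed_sequentially[OF closed_Y xY l1])
  have "u \<in> U y"
  proof (rule ccontr)
    assume "u \<notin> U y"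
    then obtain e where e: "0 < e" "cball u e \<subseteq> - U y"
      using compact_imp_closed[OF compact_U[OF y]] open_contains_cball[of "- U y"] by auto
    then have V: "open (- cball u e) \<and> U y \<subseteq> - cball u e" by auto
    have "\<exists>d>0. \<forall>y'\<in>Y. dist y' y < d \<longrightarrow> U y' \<subseteq> - cball u e"
      using usc_U[unfolded usc_on_def, rule_format, OF y V] by simp
    then obtain d where d: "d > 0" "\<And>y'. y' \<in> Y \<Longrightarrow> dist y' y < d \<Longrightarrow> U y' \<subseteq> - cball u e"
      by blast
    have "\<forall>\<^sub>F n in sequentially. dist (fst (x n)) y < d" using l1 d by (auto dest: tendstoD)
    moreover have "\<forall>\<^sub>F n in sequentially. dist (snd (x n)) u < e" using l2 e by (auto dest: tendstoD)
    ultimately have "\<forall>\<^sub>F n in sequentially. False"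
    proof eventually_elim
      case (elim n)
      then have "snd (x n) \<in> - cball u e" using d(2)[OF xY] xU by blast
      then show False using elim(2) by (auto simp: dist_commute)
    qed
    then show False by simp
  qed
  moreover have "f (y, u) \<in> Y"
  proof -
    have "l \<in> UNIV \<times> U0" using \<open>u \<in> U y\<close> U_subset[OF y] l by auto
    moreover have "\<forall>n. x n \<in> UNIV \<times> U0" using x G_subset by blast
    ultimately have "(\<lambda>n. f (x n)) \<longlonglongrightarrow> f l"
      using continuous_f[unfolded continuous_on_sequentially, rule_format, of l x] lim
      by (simp add: comp_def)
    from closed_sequentially[OF closed_Y _ this] show ?thesis using G_f x l by auto
  qed
  ultimately show "l \<in> G" using y l by (simp add: in_G_iff)
qed

text \<open>Only the control component is lost in the projection, and it ranges over a compact set.\<close>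
lemma closed_projection:
  assumes C: "closed C" "C \<subseteq> G"
  shows "closed (fst ` C)"
  unfolding closed_sequential_limits
proof (intro allI impI, elim conjE)
  fix y :: "nat \<Rightarrow> 'a" and l
  assume y: "\<forall>n. y n \<in> fst ` C" and lim: "y \<longlonglongrightarrow> l"
  then have "\<forall>n. \<exists>u. (y n, u) \<in> C" by fastforce
  then obtain u where u: "\<And>n. (y n, u n) \<in> C" by metis
  then have "\<And>n. u n \<in> U0" using C G_subset by auto
  then obtain v r where r: "strict_mono (r :: nat \<Rightarrow> nat)" "(u \<circ> r) \<longlonglongrightarrow> v"
    using compact_U0 unfolding compact_def by metis
  have "(\<lambda>n. (y (r n), u (r n))) \<longlonglongrightarrow> (l, v)"
    using r LIMSEQ_subseq_LIMSEQ[OF lim r(1)] by (intro tendsto_Pair) (auto simp: comp_def)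
  from closed_sequentially[OF C(1) u this] have "(l, v) \<in> C" .
  then show "l \<in> fst ` C" by force
qed

lemma compact_if_bounded_states:
  assumes "closed C" "C \<subseteq> G" "\<And>z. z \<in> C \<Longrightarrow> norm (fst z) \<le> r"
  shows "compact C"
proof -
  have "C = (cball 0 r \<times> U0) \<inter> C" using assms G_subset by auto
  moreover have "compact ((cball (0::'a) r \<times> U0) \<inter> C)"
    using assms compact_U0 by (intro compact_Int_closed compact_Times) auto
  ultimately show ?thesis by simp
qed

lemma compact_preimage_fst:
  assumes "compact K" shows "compact {z \<in> G. fst z \<in> K}"
proof -
  obtain r where r: "\<And>x. x \<in> K \<Longrightarrow> norm x \<le> r"
    using compact_imp_bounded[OF assms] unfolding bounded_iff by blast
  have "{z \<in> G. fst z \<in> K} = G \<inter> fst -` K" by auto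
  then have "closed {z \<in> G. fst z \<in> K}"
    using closed_G assms by (simp add: closed_Int closed_vimage_fst compact_imp_closed)
  then show ?thesis by (rule compact_if_bounded_states[of _ r]) (use r in auto)
qed

text \<open>This is where the growth of \<open>f\<close> enters: points of the graph that \<open>f\<close> maps into a bounded set
  have bounded states.\<close>
lemma compact_preimage_f:
  assumes "compact K" shows "compact {z \<in> G. f z \<in> K}"
proof -
  obtain r where r: "\<And>x. x \<in> K \<Longrightarrow> norm x \<le> r"
    using compact_imp_bounded[OF assms] unfolding bounded_iff by blast
  obtain b where b: "\<And>y. b \<le> norm y \<Longrightarrow> \<forall>u\<in>U0. r + 1 \<le> norm (f (y, u))"
    using f_at_infinity[of "r + 1"] unfolding eventually_at_infinity by blast
  have "{z \<in> G. f z \<in> K} = G \<inter> f -` K" by auto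
  then have "closed {z \<in> G. f z \<in> K}"
    using continuous_closed_preimage[OF continuous_on_G_f closed_G] assms
    by (simp add: compact_imp_closed)
  moreover have "norm (fst z) \<le> b" if "z \<in> {z \<in> G. f z \<in> K}" for z
  proof (rule ccontr)
    assume "\<not> norm (fst z) \<le> b"
    then have "r + 1 \<le> norm (f z)" using b[of "fst z"] that G_subset by (cases z) auto
    then show False using r[of "f z"] that by auto
  qed
  ultimately show ?thesis by (intro compact_if_bounded_states[of _ b]) auto
qed

text \<open>Both \<open>f\<close> and the projection to the state are proper on the graph, so both extend to the
  compactifications, and at infinity the two terms cancel.\<close>
lemma continuous_map_increment:
  assumes \<phi>: "continuous_map (compactif Y) euclideanreal \<phi>"
  shows "continuous_map (compactif G) euclideanreal (\<lambda>z. \<phi> (map_option f z) - \<phi> (map_option fst z))"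
proof -
  have "continuous_map (compactif G) (compactif Y) (map_option f)"
    using continuous_on_G_f G_f compact_preimage_f
    by (intro continuous_map_compactif_map_option) auto
  moreover have "continuous_map (compactif G) (compactif Y) (map_option fst)"
    using G_fst compact_preimage_fst
    by (intro continuous_map_compactif_map_option continuous_on_fst continuous_on_id) auto
  ultimately show ?thesis
    using continuous_map_compose[OF _ \<phi>]
    by (intro continuous_map_diff) (auto simp: comp_def)
qed

section \<open>Invariance of the elements of W\<close>

lemma measurable_G:
  "continuous_on G h \<Longrightarrow> h \<in> borel_measurable (borel_of (top_of_set G))"
  by (intro continuous_map_borel_of) simp

text \<open>Membership in \<open>W\<close> only tests functions that are continuous up to infinity. Among them are the
  bump functions \<open>max 0 (1 - n dist(y, K))\<close> of compact sets \<open>K\<close>, whose limit is the indicator of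
  \<open>K\<close>, and compact sets generate the Borel sets and are closed under intersection.\<close>
lemma invariant_distr:
  assumes \<gamma>: "\<gamma> \<in> W Y U f"
  shows "distr \<gamma> borel f = distr \<gamma> borel fst"
proof -
  have \<gamma>p: "\<gamma> \<in> borel_prob (top_of_set G)" using \<gamma> by (simp add: W_def)
  interpret prob_space \<gamma> by (rule prob_space_borel_prob[OF \<gamma>p])
  have f: "f \<in> borel_measurable \<gamma>" and fst: "fst \<in> borel_measurable \<gamma>"
    using measurable_G[OF continuous_on_G_f] measurable_G[OF continuous_on_fst[OF continuous_on_id]]
    by (simp_all add: measurable_borel_prob[OF \<gamma>p])
  have space: "space \<gamma> = G" by (simp add: space_borel_prob[OF \<gamma>p])
  have eq: "emeasure (distr \<gamma> borel f) K = emeasure (distr \<gamma> borel fst) K" if K: "compact K" for K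
  proof (cases "K = {}")
    case False
    have K_borel: "K \<in> sets borel" by (rule borel_closed[OF compact_imp_closed[OF K]])
    define \<psi> where "\<psi> n y = max 0 (1 - real n * infdist y K)" for n y
    have cont: "continuous_on A (\<psi> n)" for n A
      unfolding \<psi>_def by (intro continuous_intros)
    have bd: "\<bar>\<psi> n y\<bar> \<le> 1" for n y by (auto simp: \<psi>_def infdist_nonneg)
    have lim: "(\<lambda>n. \<psi> n y) \<longlonglongrightarrow> indicator K y" for y
    proof (cases "y \<in> K")
      case False
      then have "0 < infdist y K"
        using K \<open>K \<noteq> {}\<close> by (simp add: infdist_pos_not_in_closed compact_imp_closed)
      then obtain m where m: "1 < real m * infdist y K" using reals_Archimedean3 by metis
      have "\<psi> n y = 0" if "n \<ge> m" for n
      proof -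
        have "real m * infdist y K \<le> real n * infdist y K"
          using that by (intro mult_right_mono) (auto simp: infdist_nonneg)
        then show ?thesis using m by (simp add: \<psi>_def)
      qed
      then have "\<forall>\<^sub>F n in sequentially. \<psi> n y = 0" by (auto simp: eventually_sequentially)
      then show ?thesis using False by (simp add: tendsto_eventually)
    qed (simp add: \<psi>_def)
    have int: "(\<integral>z. \<psi> n (f z) \<partial>\<gamma>) = (\<integral>z. \<psi> n (fst z) \<partial>\<gamma>)" if n: "n > 0" for n
    proof -
      have "continuous_map (compactif Y) euclideanreal (case_option 0 (\<psi> n))"
      proof (rule continuous_map_compactif_compact_support[OF closed_Y cont])
        show "compact {x. infdist x K \<le> 1}"
          using K \<open>K \<noteq> {}\<close> by (intro compact_infdist_le) auto
        fix y assume "y \<in> Y - {x. infdist x K \<le> 1}"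
        then have "1 < infdist y K" by auto
        also have "1 * infdist y K \<le> real n * infdist y K"
          using n by (intro mult_right_mono) (auto simp: infdist_nonneg)
        finally show "\<psi> n y = 0" by (simp add: \<psi>_def)
      qed
      then have "(\<integral>z. \<psi> n (f z) - \<psi> n (fst z) \<partial>\<gamma>) = 0"
        using \<gamma> by (fastforce simp: W_def case_prod_unfold)
      moreover have "integrable \<gamma> (\<lambda>z. \<psi> n (g z))" if "g \<in> borel_measurable \<gamma>" for g
        using measurable_compose[OF that borel_measurable_continuous_onI[OF cont]] bd
        by (intro integrable_const_bound[of _ 1]) auto
      ultimately show ?thesis using f fst by simp
    qed
    have conv: "(\<lambda>n. \<integral>z. \<psi> n (g z) \<partial>\<gamma>) \<longlonglongrightarrow> measure (distr \<gamma> borel g) K"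
      if g: "g \<in> borel_measurable \<gamma>" for g
    proof -
      have "(\<lambda>n. \<integral>z. \<psi> n (g z) \<partial>\<gamma>) \<longlonglongrightarrow> (\<integral>z. indicator K (g z) \<partial>\<gamma>)"
      proof (rule integral_dominated_convergence[where w = "\<lambda>_. 1"])
        show "(\<lambda>z. indicator K (g z)) \<in> borel_measurable \<gamma>"
          by (rule measurable_compose[OF g borel_measurable_indicator[OF K_borel]])
        show "(\<lambda>z. \<psi> n (g z)) \<in> borel_measurable \<gamma>" for n
          by (rule measurable_compose[OF g borel_measurable_continuous_onI[OF cont]])
      qed (use lim bd in auto)
      also have "(\<integral>z. indicator K (g z) \<partial>\<gamma>) = (\<integral>y. (indicator K y :: real) \<partial>distr \<gamma> borel g)"
        by (subst integral_distr[OF g borel_measurable_indicator[OF K_borel]]) (rule refl)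
      also have "\<dots> = measure (distr \<gamma> borel g) K" by simp
      finally show ?thesis .
    qed
    have "(\<lambda>n. \<integral>z. \<psi> n (f z) \<partial>\<gamma>) \<longlonglongrightarrow> measure (distr \<gamma> borel fst) K"
      using conv[OF fst] by (rule Lim_transform_eventually)
        (use int in \<open>auto simp: eventually_sequentially intro!: exI[of _ 1]\<close>)
    then have "measure (distr \<gamma> borel f) K = measure (distr \<gamma> borel fst) K"
      using conv[OF f] LIMSEQ_unique by blast
    then show ?thesis
      using prob_space_distr[OF f] prob_space_distr[OF fst]
      by (simp add: finite_measure.emeasure_eq_measure prob_space.finite_measure)
  qed simp
  have gen: "sets (borel :: 'a measure) = sigma_sets UNIV (Collect compact)"
  proof
    have "A \<in> sigma_sets UNIV (Collect compact)" if "closed A" for A :: "'a set"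
    proof -
      have "A = (\<Union>n::nat. A \<inter> cball 0 (real n))"
        by (auto simp: real_arch_simple)
      moreover have "(\<Union>n::nat. A \<inter> cball 0 (real n)) \<in> sigma_sets UNIV (Collect compact)"
        using closed_Int_compact[OF that compact_cball]
        by (intro sigma_sets.Union sigma_sets.Basic) simp
      ultimately show ?thesis by simp
    qed
    then show "sets (borel :: 'a measure) \<subseteq> sigma_sets UNIV (Collect compact)"
      unfolding borel_eq_closed by (subst sets_measure_of) (auto intro!: sigma_sets_mono)
    show "sigma_sets UNIV (Collect compact) \<subseteq> sets (borel :: 'a measure)"
      using sets.sigma_sets_subset[of "Collect compact" "borel :: 'a measure"]
        borel_closed[OF compact_imp_closed] by auto
  qed
  show ?thesis
  proof (rule measure_eqI_generator_eq[where E = "Collect compact" and \<Omega> = UNIV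
        and A = "\<lambda>n. cball 0 (real n)"])
    show "Int_stable (Collect compact :: 'a set set)"
      by (auto simp: Int_stable_def compact_Int)
    show "(\<Union>i. cball (0::'a) (real i)) = UNIV" by (auto simp: real_arch_simple)
    interpret D: prob_space "distr \<gamma> borel f" by (rule prob_space_distr[OF f])
    show "emeasure (distr \<gamma> borel f) (cball 0 (real i)) \<noteq> \<infinity>" for i by simp
  qed (use eq gen in auto)
qed

lemma integral_invariant:
  fixes v :: "'a \<Rightarrow> real"
  assumes \<gamma>: "\<gamma> \<in> W Y U f" and v: "v \<in> borel_measurable borel"
  shows "(\<integral>z. v (f z) \<partial>\<gamma>) = (\<integral>z. v (fst z) \<partial>\<gamma>)"
proof -
  have \<gamma>p: "\<gamma> \<in> borel_prob (top_of_set G)" using \<gamma> by (simp add: W_def)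
  have "f \<in> borel_measurable \<gamma>" "fst \<in> borel_measurable \<gamma>"
    using measurable_G[OF continuous_on_G_f] measurable_G[OF continuous_on_fst[OF continuous_on_id]]
    by (simp_all add: measurable_borel_prob[OF \<gamma>p])
  then show ?thesis
    using v integral_distr[of f \<gamma> borel v] integral_distr[of fst \<gamma> borel v] invariant_distr[OF \<gamma>]
    by simp
qed

section \<open>Finite horizon value functions\<close>

text \<open>The optimal total reward over \<open>n\<close> steps with running reward \<open>q\<close> and discount factor \<open>\<alpha>\<close>, where
  \<open>\<alpha> = 1\<close> is admitted for the averaged problem. It is meaningful for initial states in \<open>Y\<close>, where
  viability makes the set of available controls nonempty.\<close>
primrec horizon_value :: "('a \<times> 'u \<Rightarrow> real) \<Rightarrow> real \<Rightarrow> nat \<Rightarrow> 'a \<Rightarrow> real" where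
  "horizon_value q \<alpha> 0 y = 0"
| "horizon_value q \<alpha> (Suc n) y = (SUP u\<in>{u. (y, u) \<in> G}. q (y, u) + \<alpha> * horizon_value q \<alpha> n (f (y, u)))"

context
  fixes q :: "'a \<times> 'u \<Rightarrow> real" and \<alpha> C :: real
  assumes q: "continuous_on G q" and q_bound: "\<And>z. z \<in> G \<Longrightarrow> \<bar>q z\<bar> \<le> C"
    and \<alpha>: "0 < \<alpha>" "\<alpha> \<le> 1"
begin

lemma horizon_step_bound:
  assumes V: "\<And>y. y \<in> Y \<Longrightarrow> \<bar>horizon_value q \<alpha> n y\<bar> \<le> real n * C" and z: "z \<in> G"
  shows "\<bar>q z + \<alpha> * horizon_value q \<alpha> n (f z)\<bar> \<le> real (Suc n) * C"
proof -
  have "\<bar>\<alpha> * horizon_value q \<alpha> n (f z)\<bar> \<le> 1 * (real n * C)"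
    unfolding abs_mult using \<alpha> V[OF G_f[OF z]] by (intro mult_mono) auto
  then show ?thesis using q_bound[OF z] by (simp add: algebra_simps)
qed

lemma horizon_value_bound: "y \<in> Y \<Longrightarrow> \<bar>horizon_value q \<alpha> n y\<bar> \<le> real n * C"
proof (induction n arbitrary: y)
  case (Suc n)
  obtain u where u: "(y, u) \<in> G" using exists_G_fiber[OF Suc.prems] .
  let ?S = "(\<lambda>u. q (y, u) + \<alpha> * horizon_value q \<alpha> n (f (y, u))) ` {u. (y, u) \<in> G}"
  have b: "\<bar>s\<bar> \<le> real (Suc n) * C" if "s \<in> ?S" for s
    using that horizon_step_bound[OF Suc.IH] by fastforce
  have "?S \<noteq> {}" using u by blast
  then have "\<bar>Sup ?S\<bar> \<le> real (Suc n) * C" using b by (intro cSup_abs_le) auto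
  then show ?case by simp
qed simp

lemma bdd_above_horizon_step:
  "bdd_above ((\<lambda>u. q (y, u) + \<alpha> * horizon_value q \<alpha> n (f (y, u))) ` {u. (y, u) \<in> G})"
proof (rule bdd_aboveI2)
  fix u assume "u \<in> {u. (y, u) \<in> G}"
  then have "\<bar>q (y, u) + \<alpha> * horizon_value q \<alpha> n (f (y, u))\<bar> \<le> real (Suc n) * C"
    by (intro horizon_step_bound horizon_value_bound) auto
  then show "q (y, u) + \<alpha> * horizon_value q \<alpha> n (f (y, u)) \<le> real (Suc n) * C" by linarith
qed

lemma horizon_value_Suc_ge:
  "z \<in> G \<Longrightarrow> q z + \<alpha> * horizon_value q \<alpha> n (f z) \<le> horizon_value q \<alpha> (Suc n) (fst z)"
  using cSUP_upper[OF _ bdd_above_horizon_step, of "snd z" "fst z" n] by simp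

lemma horizon_value_Suc_approx:
  assumes "y \<in> Y" "0 < e"
  obtains u where "(y, u) \<in> G" "horizon_value q \<alpha> (Suc n) y - e < q (y, u) + \<alpha> * horizon_value q \<alpha> n (f (y, u))"
proof -
  have "{u. (y, u) \<in> G} \<noteq> {}" using exists_G_fiber[OF assms(1)] by blast
  from less_cSUP_iff[OF this bdd_above_horizon_step, of "horizon_value q \<alpha> (Suc n) y - e" n]
  show ?thesis using that assms(2) by auto
qed

text \<open>The sum of the continuous reward and the upper semicontinuous continuation value is upper
  semicontinuous; along a convergent sequence the reward is eventually at most \<open>q l + e\<close>, which
  leaves at least \<open>c - q l - e\<close> for the continuation.\<close>
lemma closed_superlevel_step:
  assumes V: "\<And>c. closed {y \<in> Y. c \<le> horizon_value q \<alpha> n y}"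
  shows "closed {z \<in> G. c \<le> q z + \<alpha> * horizon_value q \<alpha> n (f z)}"
  unfolding closed_sequential_limits
proof (intro allI impI, elim conjE)
  fix x :: "nat \<Rightarrow> 'a \<times> 'u" and l
  assume x: "\<forall>k. x k \<in> {z \<in> G. c \<le> q z + \<alpha> * horizon_value q \<alpha> n (f z)}" and lim: "x \<longlonglongrightarrow> l"
  have xG: "\<And>k. x k \<in> G" using x by auto
  have l: "l \<in> G" by (rule closed_sequentially[OF closed_G xG lim])
  have lim_q: "(\<lambda>k. q (x k)) \<longlonglongrightarrow> q l" and lim_f: "(\<lambda>k. f (x k)) \<longlonglongrightarrow> f l"
    using q[unfolded continuous_on_sequentially, rule_format, of l x]
      continuous_on_G_f[unfolded continuous_on_sequentially, rule_format, of l x] xG l lim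
    by (simp_all add: comp_def)
  have "c \<le> q l + \<alpha> * horizon_value q \<alpha> n (f l)"
  proof (rule field_le_epsilon)
    fix e :: real assume e: "0 < e"
    have "\<forall>\<^sub>F k in sequentially. q (x k) < q l + e"
      using order_tendstoD(2)[OF lim_q, of "q l + e"] e by simp
    then have "\<forall>\<^sub>F k in sequentially. f (x k) \<in> {y \<in> Y. (c - q l - e) / \<alpha> \<le> horizon_value q \<alpha> n y}"
    proof eventually_elim
      case (elim k)
      have "c \<le> q (x k) + \<alpha> * horizon_value q \<alpha> n (f (x k))" using x by simp
      then have "c - q l - e \<le> \<alpha> * horizon_value q \<alpha> n (f (x k))" using elim by linarith
      then show ?case using \<alpha> G_f[OF xG] by (simp add: pos_divide_le_eq mult.commute)
    qed
    from Lim_in_closed_set[OF V this _ lim_f]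
    show "c \<le> q l + \<alpha> * horizon_value q \<alpha> n (f l) + e"
      using \<alpha> by (simp add: pos_divide_le_eq mult.commute)
  qed
  then show "l \<in> {z \<in> G. c \<le> q z + \<alpha> * horizon_value q \<alpha> n (f z)}" using l by simp
qed

text \<open>Upper semicontinuity of the value function. Superlevel sets of a supremum are intersections of
  projections of slightly lower superlevel sets, so no maximiser has to be found.\<close>
lemma closed_superlevel_horizon_value: "closed {y \<in> Y. c \<le> horizon_value q \<alpha> n y}"
proof (induction n arbitrary: c)
  case 0
  then show ?case using closed_Y by (cases "c \<le> 0") auto
next
  case (Suc n)
  let ?g = "\<lambda>z. q z + \<alpha> * horizon_value q \<alpha> n (f z)"
  let ?P = "\<lambda>k::nat. fst ` {z \<in> G. c - 1 / real (Suc k) \<le> ?g z}"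
  have "{y \<in> Y. c \<le> horizon_value q \<alpha> (Suc n) y} = (\<Inter>k. ?P k)"
  proof (intro equalityI subsetI)
    fix y assume y: "y \<in> {y \<in> Y. c \<le> horizon_value q \<alpha> (Suc n) y}"
    have "y \<in> ?P k" for k
    proof -
      obtain u where "(y, u) \<in> G" "horizon_value q \<alpha> (Suc n) y - 1 / real (Suc k) < ?g (y, u)"
        using y horizon_value_Suc_approx[of y "1 / real (Suc k)" n] by auto
      then show ?thesis using y by (intro image_eqI[of _ _ "(y, u)"]) auto
    qed
    then show "y \<in> (\<Inter>k. ?P k)" by blast
  next
    fix y assume y: "y \<in> (\<Inter>k. ?P k)"
    then have "y \<in> ?P 0" by blast
    then have "y \<in> Y" using G_fst by blast
    moreover have "c \<le> horizon_value q \<alpha> (Suc n) y"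
    proof (rule field_le_epsilon)
      fix e :: real assume "0 < e"
      then obtain k where k: "1 / real (Suc k) < e" using nat_approx_posE by blast
      have "y \<in> ?P k" using y by blast
      then obtain z where z: "z \<in> G" "y = fst z" "c - 1 / real (Suc k) \<le> ?g z" by blast
      then show "c \<le> horizon_value q \<alpha> (Suc n) y + e"
        using horizon_value_Suc_ge[OF z(1), of n, folded z(2)] k by linarith
    qed
    ultimately show "y \<in> {y \<in> Y. c \<le> horizon_value q \<alpha> (Suc n) y}" by simp
  qed
  moreover have "closed (\<Inter>k. ?P k)"
    by (intro closed_INT ballI closed_projection closed_superlevel_step Suc.IH) auto
  ultimately show ?case by simp
qed

text \<open>Outside \<open>Y\<close> the supremum may be over the empty set, so the function is cut off there.\<close>
lemma measurable_horizon_value: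
  "(\<lambda>y. if y \<in> Y then horizon_value q \<alpha> n y else 0) \<in> borel_measurable borel" (is "?v \<in> _")
  unfolding borel_measurable_iff_ge
proof
  fix c :: real
  have "{y \<in> space borel. c \<le> ?v y} = {y \<in> Y. c \<le> horizon_value q \<alpha> n y} \<union> (if c \<le> 0 then - Y else {})"
    by auto
  also have "\<dots> \<in> sets borel"
    using borel_closed[OF closed_superlevel_horizon_value] borel_open[of "- Y"] closed_Y
    by (intro sets.Un) (auto simp: open_Compl)
  finally show "{y \<in> space borel. c \<le> ?v y} \<in> sets borel" .
qed

lemma
  assumes \<gamma>: "\<gamma> \<in> borel_prob (top_of_set G)"
    and g: "continuous_on G g" "\<And>z. z \<in> G \<Longrightarrow> g z \<in> Y"
  shows integrable_horizon_value: "integrable \<gamma> (\<lambda>z. horizon_value q \<alpha> n (g z))" (is ?thesis1)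
    and integral_horizon_value_truncate: "(\<integral>z. horizon_value q \<alpha> n (g z) \<partial>\<gamma>) =
      (\<integral>z. (if g z \<in> Y then horizon_value q \<alpha> n (g z) else 0) \<partial>\<gamma>)" (is ?thesis2)
proof -
  let ?v = "\<lambda>y. if y \<in> Y then horizon_value q \<alpha> n y else 0"
  have space: "space \<gamma> = G" by (simp add: space_borel_prob[OF \<gamma>])
  have "integrable \<gamma> (\<lambda>z. ?v (g z))"
    using g horizon_value_bound
    by (intro integrable_borel_prob[OF \<gamma>, of _ "real n * C"]
        measurable_compose[OF measurable_G[OF g(1)] measurable_horizon_value]) auto
  also have "?this \<longleftrightarrow> ?thesis1"
    using g by (intro Bochner_Integration.integrable_cong) (auto simp: space)
  finally show ?thesis1 .
  show ?thesis2
    using g by (intro Bochner_Integration.integral_cong) (auto simp: space)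
qed

text \<open>Integrate the dynamic programming inequality and use invariance to replace \<open>V\<^sub>n (f z)\<close> by
  \<open>V\<^sub>n (fst z)\<close>.\<close>
lemma integral_horizon_value_ge:
  assumes \<gamma>: "\<gamma> \<in> W Y U f"
  shows "(\<Sum>t<n. \<alpha> ^ t) * integral\<^sup>L \<gamma> q \<le> (\<integral>z. horizon_value q \<alpha> n (fst z) \<partial>\<gamma>)"
proof -
  have \<gamma>p: "\<gamma> \<in> borel_prob (top_of_set G)" using \<gamma> by (simp add: W_def)
  have space: "space \<gamma> = G" by (simp add: space_borel_prob[OF \<gamma>p])
  have int_q: "integrable \<gamma> q"
    using q_bound by (intro integrable_borel_prob[OF \<gamma>p measurable_G[OF q]]) auto
  note f = integrable_horizon_value[OF \<gamma>p continuous_on_G_f G_f]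
    integral_horizon_value_truncate[OF \<gamma>p continuous_on_G_f G_f]
  note fst = integrable_horizon_value[OF \<gamma>p continuous_on_fst[OF continuous_on_id] G_fst]
    integral_horizon_value_truncate[OF \<gamma>p continuous_on_fst[OF continuous_on_id] G_fst]
  show ?thesis
  proof (induction n)
    case (Suc n)
    have "(\<Sum>t<Suc n. \<alpha> ^ t) * integral\<^sup>L \<gamma> q
        = integral\<^sup>L \<gamma> q + \<alpha> * ((\<Sum>t<n. \<alpha> ^ t) * integral\<^sup>L \<gamma> q)"
      unfolding sum.lessThan_Suc_shift by (simp add: sum_distrib_left algebra_simps)
    also have "\<dots> \<le> integral\<^sup>L \<gamma> q + \<alpha> * (\<integral>z. horizon_value q \<alpha> n (fst z) \<partial>\<gamma>)"
      using Suc.IH \<alpha> by (intro add_left_mono mult_left_mono) auto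
    also have "(\<integral>z. horizon_value q \<alpha> n (fst z) \<partial>\<gamma>) = (\<integral>z. horizon_value q \<alpha> n (f z) \<partial>\<gamma>)"
      using integral_invariant[OF \<gamma> measurable_horizon_value[of n]] f(2) fst(2) by simp
    also have "integral\<^sup>L \<gamma> q + \<alpha> * \<dots> = (\<integral>z. q z + \<alpha> * horizon_value q \<alpha> n (f z) \<partial>\<gamma>)"
      using int_q f(1) by simp
    also have "\<dots> \<le> (\<integral>z. horizon_value q \<alpha> (Suc n) (fst z) \<partial>\<gamma>)"
      using int_q f(1) fst(1)[of "Suc n"] horizon_value_Suc_ge
      by (intro integral_mono) (auto simp: space simp del: horizon_value.simps)
    finally show ?case .
  qed simp
qed

lemma near_optimal_process:
  "y \<in> Y \<Longrightarrow> 0 < e \<Longrightarrow> \<exists>u. (\<forall>t<n. process f y u t \<in> G) \<and>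
    horizon_value q \<alpha> n y - e \<le> (\<Sum>t<n. \<alpha> ^ t * q (process f y u t))"
proof (induction n arbitrary: y e)
  case (Suc n)
  obtain v where v: "(y, v) \<in> G"
    "horizon_value q \<alpha> (Suc n) y - e / 2 < q (y, v) + \<alpha> * horizon_value q \<alpha> n (f (y, v))"
    using horizon_value_Suc_approx[of y "e / 2" n] Suc.prems by auto
  obtain u where u: "\<And>t. t < n \<Longrightarrow> process f (f (y, v)) u t \<in> G"
    "horizon_value q \<alpha> n (f (y, v)) - e / 2 \<le> (\<Sum>t<n. \<alpha> ^ t * q (process f (f (y, v)) u t))"
    using Suc.IH[of "f (y, v)" "e / 2"] G_f[OF v(1)] Suc.prems by auto
  have "(\<Sum>t<Suc n. \<alpha> ^ t * q (process f y (case_nat v u) t))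
      = q (y, v) + \<alpha> * (\<Sum>t<n. \<alpha> ^ t * q (process f (f (y, v)) u t))"
    unfolding sum.lessThan_Suc_shift process_cons by (simp add: sum_distrib_left mult.assoc)
  moreover have "\<alpha> * (horizon_value q \<alpha> n (f (y, v)) - e / 2) \<le> \<alpha> * (\<Sum>t<n. \<alpha> ^ t * q (process f (f (y, v)) u t))"
    using \<alpha> u(2) by (intro mult_left_mono) auto
  moreover have "\<alpha> * (e / 2) \<le> 1 * (e / 2)" using \<alpha> Suc.prems by (intro mult_right_mono) auto
  ultimately have "horizon_value q \<alpha> (Suc n) y - e \<le> (\<Sum>t<Suc n. \<alpha> ^ t * q (process f y (case_nat v u) t))"
    using v(2) by (simp add: right_diff_distrib del: horizon_value.simps)
  moreover have "\<forall>t<Suc n. process f y (case_nat v u) t \<in> G"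
    using u(1) v(1) by (auto simp: less_Suc_eq_0_disj process_cons)
  ultimately show ?case by blast
qed simp

text \<open>Some initial state has a value of at least the mean, up to \<open>e / 2\<close>; a near-optimal process
  from there costs another \<open>e / 2\<close>.\<close>
lemma exists_process_ge_integral:
  assumes \<gamma>: "\<gamma> \<in> W Y U f" and e: "0 < e"
  obtains y u where "y \<in> Y" "\<And>t. t < n \<Longrightarrow> process f y u t \<in> G"
    "(\<Sum>t<n. \<alpha> ^ t) * integral\<^sup>L \<gamma> q - e \<le> (\<Sum>t<n. \<alpha> ^ t * q (process f y u t))"
proof -
  have \<gamma>p: "\<gamma> \<in> borel_prob (top_of_set G)" using \<gamma> by (simp add: W_def)
  interpret prob_space \<gamma> by (rule prob_space_borel_prob[OF \<gamma>p])
  let ?c = "(\<Sum>t<n. \<alpha> ^ t) * integral\<^sup>L \<gamma> q"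
  have "\<exists>z\<in>G. ?c - e / 2 \<le> horizon_value q \<alpha> n (fst z)"
  proof (rule ccontr)
    assume *: "\<not> ?thesis"
    have "(\<integral>z. horizon_value q \<alpha> n (fst z) \<partial>\<gamma>) \<le> (\<integral>z. ?c - e / 2 \<partial>\<gamma>)"
      using * integrable_horizon_value[OF \<gamma>p continuous_on_fst[OF continuous_on_id] G_fst]
      by (intro integral_mono) (auto simp: space_borel_prob[OF \<gamma>p] not_le less_imp_le)
    also have "\<dots> = ?c - e / 2" by (simp add: prob_space)
    finally show False using integral_horizon_value_ge[OF \<gamma>, of n] e by linarith
  qed
  then obtain z where z: "z \<in> G" "?c - e / 2 \<le> horizon_value q \<alpha> n (fst z)" by blast
  then show ?thesis
    using near_optimal_process[of "fst z" "e / 2" n] G_fst[OF z(1)] e that[of "fst z"] by fastforce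
qed

end

section \<open>Integrals against the discounted and averaging occupational measures\<close>

lemma controls_iff: "u \<in> controls Y U f y \<longleftrightarrow> (\<forall>t. process f y u t \<in> G)"
  using controls_process by (auto simp: controls_def process_def in_G_iff)

text \<open>By viability an admissible process on a finite horizon can be continued forever.\<close>
lemma extend_process:
  "y \<in> Y \<Longrightarrow> (\<And>t. t < n \<Longrightarrow> process f y u t \<in> G) \<Longrightarrow>
    \<exists>u' \<in> controls Y U f y. \<forall>t<n. process f y u' t = process f y u t"
proof (induction n arbitrary: y u)
  case 0
  then show ?case using viable by auto
next
  case (Suc n)
  have u: "u = case_nat (u 0) (\<lambda>t. u (Suc t))" by (auto simp: fun_eq_iff split: nat.splits)
  note cons = process_cons[of y "u 0" "\<lambda>t. u (Suc t)", folded u]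
  have G0: "(y, u 0) \<in> G" using Suc.prems(2)[of 0] cons(1) by simp
  then obtain u' where u': "u' \<in> controls Y U f (f (y, u 0))"
    "\<And>t. t < n \<Longrightarrow> process f (f (y, u 0)) u' t = process f (f (y, u 0)) (\<lambda>t. u (Suc t)) t"
    using Suc.IH[of "f (y, u 0)" "\<lambda>t. u (Suc t)"] Suc.prems(2)[of "Suc _"] G_f[OF G0] cons(2) by auto
  have "process f y (case_nat (u 0) u') t \<in> G" for t
    using G0 u'(1) by (cases t) (auto simp: process_cons controls_iff)
  moreover have "process f y (case_nat (u 0) u') t = process f y u t" if "t < Suc n" for t
    using that u'(2) by (cases t) (auto simp: process_cons cons)
  ultimately show ?case
    by (intro bexI[of _ "case_nat (u 0) u'"]) (auto simp: controls_iff)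
qed

lemma Gamma_disc_borel_prob:
  "0 < \<alpha> \<Longrightarrow> \<alpha> < 1 \<Longrightarrow> Gamma_disc Y U f \<alpha> \<subseteq> borel_prob (top_of_set G)"
  by (auto simp: Gamma_disc_def controls_iff intro!: disc_occ_prob)

lemma Gamma_avg_borel_prob: "0 < S \<Longrightarrow> Gamma_avg Y U f S \<subseteq> borel_prob (top_of_set G)"
  by (auto simp: Gamma_avg_def controls_fin_def intro!: avg_occ_prob)

lemma Gamma_avg_ge:
  fixes q :: "'a \<times> 'u \<Rightarrow> real"
  assumes \<gamma>: "\<gamma> \<in> W Y U f" and S: "0 < S" and e: "0 < e"
    and q: "continuous_on G q" "\<And>z. z \<in> G \<Longrightarrow> \<bar>q z\<bar> \<le> C"
  shows "\<exists>\<nu>\<in>Gamma_avg Y U f S. integral\<^sup>L \<gamma> q - e \<le> integral\<^sup>L \<nu> q"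
proof -
  have Se: "0 < real S * e" using S e by simp
  obtain y u where y: "y \<in> Y" and u: "\<And>t. t < S \<Longrightarrow> process f y u t \<in> G"
    and ge: "real S * integral\<^sup>L \<gamma> q - real S * e \<le> (\<Sum>t<S. q (process f y u t))"
    using exists_process_ge_integral[OF q _ _ \<gamma> Se, of 1 S] by auto
  let ?\<nu> = "avg_occ G S (process f y u)"
  have "integral\<^sup>L ?\<nu> q = (\<Sum>t<S. q (process f y u t)) / real S"
    by (rule integral_avg_occ[OF u S measurable_G[OF q(1)] q(2)])
  moreover have "(integral\<^sup>L \<gamma> q - e) * real S \<le> (\<Sum>t<S. q (process f y u t))"
    using ge by (simp add: algebra_simps)
  ultimately have "integral\<^sup>L \<gamma> q - e \<le> integral\<^sup>L ?\<nu> q"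
    using S by (simp add: pos_le_divide_eq)
  moreover have "?\<nu> \<in> Gamma_avg Y U f S"
    using y u by (auto simp: Gamma_avg_def controls_fin_def)
  ultimately show ?thesis by blast
qed

text \<open>The reward is shifted to be nonnegative. Then continuing an \<open>n\<close>-step process to the infinite
  horizon cannot decrease the discounted reward. Besides the error \<open>e / 2\<close> of the process, the only loss
  against the full geometric series is the factor \<open>1 - \<alpha>\<^sup>n\<close>, which \<open>n\<close> brings close to 1.\<close>
lemma Gamma_disc_ge:
  fixes q :: "'a \<times> 'u \<Rightarrow> real"
  assumes \<gamma>: "\<gamma> \<in> W Y U f" and \<alpha>: "0 < \<alpha>" "\<alpha> < 1" and e: "0 < e"
    and q: "continuous_on G q" "\<And>z. z \<in> G \<Longrightarrow> \<bar>q z\<bar> \<le> C"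
  shows "\<exists>\<nu>\<in>Gamma_disc Y U f \<alpha>. integral\<^sup>L \<gamma> q - e \<le> integral\<^sup>L \<nu> q"
proof -
  define q' where "q' z = q z + C" for z
  have q': "continuous_on G q'" unfolding q'_def by (intro continuous_intros q)
  have q'_bounds: "0 \<le> q' z" "\<bar>q' z\<bar> \<le> 2 * C" if "z \<in> G" for z
    using q(2)[OF that] by (auto simp: q'_def)
  have shift: "integral\<^sup>L \<nu> q' = integral\<^sup>L \<nu> q + C" if "\<nu> \<in> borel_prob (top_of_set G)" for \<nu>
  proof -
    interpret prob_space \<nu> by (rule prob_space_borel_prob[OF that])
    have "integrable \<nu> q" using integrable_borel_prob[OF that measurable_G[OF q(1)], of C] q(2) by auto
    then show ?thesis unfolding q'_def by (simp add: prob_space)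
  qed
  have \<gamma>p: "\<gamma> \<in> borel_prob (top_of_set G)" using \<gamma> by (simp add: W_def)
  let ?I = "integral\<^sup>L \<gamma> q'"
  have "(\<lambda>n. \<alpha> ^ n * ?I) \<longlonglongrightarrow> 0 * ?I"
    using \<alpha> by (intro tendsto_mult LIMSEQ_power_zero tendsto_const) auto
  from order_tendstoD(2)[OF this, of "e / 2"] obtain n where n: "\<alpha> ^ n * ?I < e / 2"
    using e by (auto simp: eventually_sequentially)
  obtain y u where y: "y \<in> Y" and u: "\<And>t. t < n \<Longrightarrow> process f y u t \<in> G"
    and ge: "(\<Sum>t<n. \<alpha> ^ t) * ?I - e / 2 \<le> (\<Sum>t<n. \<alpha> ^ t * q' (process f y u t))"
    using exists_process_ge_integral[OF q' q'_bounds(2) _ _ \<gamma>, of \<alpha> "e / 2" n] \<alpha> e by auto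
  obtain u' where u': "u' \<in> controls Y U f y" "\<forall>t<n. process f y u' t = process f y u t"
    using extend_process[OF y u] by blast
  have G': "\<And>t. process f y u' t \<in> G" using u'(1) controls_iff by blast
  let ?\<nu> = "disc_occ G \<alpha> (process f y u')"
  have \<nu>: "?\<nu> \<in> Gamma_disc Y U f \<alpha>" using y u'(1) by (auto simp: Gamma_disc_def)
  have sm: "summable (\<lambda>t. \<alpha> ^ t * q' (process f y u' t))"
  proof (rule summable_comparison_test[OF _ summable_mult[OF summable_geometric[of \<alpha>], of "2 * C"]])
    show "\<exists>N. \<forall>t\<ge>N. norm (\<alpha> ^ t * q' (process f y u' t)) \<le> 2 * C * \<alpha> ^ t"
      using \<alpha> q'_bounds(2)[OF G'] by (auto simp: abs_mult mult.commute intro!: mult_left_mono)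
  qed (use \<alpha> in auto)
  have "(\<Sum>t<n. \<alpha> ^ t) * ?I - e / 2 \<le> (\<Sum>t<n. \<alpha> ^ t * q' (process f y u' t))"
    using ge u'(2) by simp
  also have "\<dots> \<le> (\<Sum>t. \<alpha> ^ t * q' (process f y u' t))"
    using \<alpha> q'_bounds(1)[OF G'] by (intro sum_le_suminf[OF sm]) auto
  finally have "(1 - \<alpha>) * ((\<Sum>t<n. \<alpha> ^ t) * ?I - e / 2) \<le> integral\<^sup>L ?\<nu> q'"
    using \<alpha> integral_disc_occ[OF G' \<alpha> measurable_G[OF q'] q'_bounds(2)]
    by (simp add: mult_left_mono)
  moreover have "(1 - \<alpha>) * (\<Sum>t<n. \<alpha> ^ t) = 1 - \<alpha> ^ n"
    by (rule one_diff_power_eq[symmetric])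
  moreover have "(1 - \<alpha>) * (e / 2) \<le> e / 2" using \<alpha> e by simp
  moreover have "(1 - \<alpha>) * ((\<Sum>t<n. \<alpha> ^ t) * ?I - e / 2)
      = ((1 - \<alpha>) * (\<Sum>t<n. \<alpha> ^ t)) * ?I - (1 - \<alpha>) * (e / 2)" by (simp add: algebra_simps)
  ultimately have "(1 - \<alpha> ^ n) * ?I - e / 2 \<le> integral\<^sup>L ?\<nu> q'" by simp
  then have "?I - e \<le> integral\<^sup>L ?\<nu> q'" using n by (simp add: left_diff_distrib)
  then have "integral\<^sup>L \<gamma> q - e \<le> integral\<^sup>L ?\<nu> q"
    using shift[OF \<gamma>p] shift[of ?\<nu>] \<nu> Gamma_disc_borel_prob[OF \<alpha>] by auto
  then show ?thesis using \<nu> by blast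
qed

context
  fixes \<phi> :: "'a option \<Rightarrow> real" and C :: real
  assumes \<phi>: "continuous_map (compactif Y) euclideanreal \<phi>"
    and \<phi>_bound: "\<And>y. y \<in> Y \<Longrightarrow> \<bar>\<phi> (Some y)\<bar> \<le> C"
begin

lemma measurable_increment:
  "(\<lambda>z. \<phi> (Some (f z)) - \<phi> (Some (fst z))) \<in> borel_measurable (borel_of (top_of_set G))"
  using continuous_map_borel_of[OF continuous_map_compactif_Some[OF continuous_map_increment[OF \<phi>]]]
  by simp

lemma increment_bound: "z \<in> G \<Longrightarrow> \<bar>\<phi> (Some (f z)) - \<phi> (Some (fst z))\<bar> \<le> 2 * C"
  using \<phi>_bound[OF G_f] \<phi>_bound[OF G_fst] by fastforce

lemma increment_process:
  "\<phi> (Some (f (process f y u t))) - \<phi> (Some (fst (process f y u t)))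
    = \<phi> (Some (trajectory f y u (Suc t))) - \<phi> (Some (trajectory f y u t))"
  by (simp add: process_def)

lemma Gamma_avg_increment:
  assumes S: "0 < S" and \<nu>: "\<nu> \<in> Gamma_avg Y U f S"
  shows "\<bar>\<integral>z. \<phi> (Some (f z)) - \<phi> (Some (fst z)) \<partial>\<nu>\<bar> \<le> 2 * C * (1 / real S)"
proof -
  obtain y u where y: "y \<in> Y" and u: "\<And>t. t < S \<Longrightarrow> process f y u t \<in> G"
    and \<nu>_eq: "\<nu> = avg_occ G S (process f y u)"
    using \<nu> by (auto simp: Gamma_avg_def controls_fin_def)
  have "(\<integral>z. \<phi> (Some (f z)) - \<phi> (Some (fst z)) \<partial>\<nu>)
      = (\<Sum>t<S. \<phi> (Some (trajectory f y u (Suc t))) - \<phi> (Some (trajectory f y u t))) / real S"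
    using integral_avg_occ[where z = "process f y u", OF u S measurable_increment increment_bound]
    unfolding \<nu>_eq increment_process by simp
  also have "\<dots> = (\<phi> (Some (trajectory f y u S)) - \<phi> (Some y)) / real S"
    by (subst sum_lessThan_telescope) simp
  finally have "(\<integral>z. \<phi> (Some (f z)) - \<phi> (Some (fst z)) \<partial>\<nu>)
      = (\<phi> (Some (trajectory f y u S)) - \<phi> (Some y)) / real S" .
  moreover have "trajectory f y u S \<in> Y"
    using G_f[OF u[of "S - 1"]] S by (cases S) (auto simp: process_def)
  then have "\<bar>\<phi> (Some (trajectory f y u S)) - \<phi> (Some y)\<bar> \<le> 2 * C"
    using \<phi>_bound[of y] \<phi>_bound[of "trajectory f y u S"] y by fastforce
  ultimately show ?thesis using S by (simp add: divide_right_mono)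
qed

text \<open>Summation by parts: the discounted sum of the increments is \<open>(1 - \<alpha>) s - a\<^sub>0\<close>, where \<open>s\<close> is the
  discounted sum of the shifted values, and \<open>(1 - \<alpha>) |s| \<le> C\<close>.\<close>
lemma Gamma_disc_increment:
  assumes \<alpha>: "0 < \<alpha>" "\<alpha> < 1" and \<nu>: "\<nu> \<in> Gamma_disc Y U f \<alpha>"
  shows "\<bar>\<integral>z. \<phi> (Some (f z)) - \<phi> (Some (fst z)) \<partial>\<nu>\<bar> \<le> 2 * C * (1 - \<alpha>)"
proof -
  obtain y u where y: "y \<in> Y" and u: "u \<in> controls Y U f y"
    and \<nu>_eq: "\<nu> = disc_occ G \<alpha> (process f y u)"
    using \<nu> by (auto simp: Gamma_disc_def)
  have G: "\<And>t. process f y u t \<in> G" using u controls_iff by blast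
  define a where "a t = \<phi> (Some (trajectory f y u t))" for t
  have a: "\<bar>a t\<bar> \<le> C" for t using \<phi>_bound[of "trajectory f y u t"] u by (auto simp: a_def controls_def)
  have sm: "summable (\<lambda>t. \<alpha> ^ t * b t)" if "\<And>t. \<bar>b t\<bar> \<le> C" for b :: "nat \<Rightarrow> real"
  proof (rule summable_comparison_test[OF _ summable_mult[OF summable_geometric[of \<alpha>], of C]])
    show "\<exists>N. \<forall>t\<ge>N. norm (\<alpha> ^ t * b t) \<le> C * \<alpha> ^ t"
      using \<alpha> that by (auto simp: abs_mult mult.commute intro!: mult_left_mono)
  qed (use \<alpha> in auto)
  let ?s = "\<Sum>t. \<alpha> ^ t * a (Suc t)"
  have sms: "summable (\<lambda>t. \<alpha> ^ t * a (Suc t))" using sm[of "\<lambda>t. a (Suc t)"] a by simp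
  have "(\<Sum>t. \<alpha> ^ t * a t) = a 0 + \<alpha> * ?s"
    using suminf_split_head[OF sm[of a]] a suminf_mult[OF sms, of \<alpha>] by (simp add: mult.assoc)
  moreover have "(\<Sum>t. \<alpha> ^ t * (a (Suc t) - a t)) = ?s - (\<Sum>t. \<alpha> ^ t * a t)"
    using suminf_diff[OF sms sm[of a]] a by (simp add: right_diff_distrib)
  ultimately have tele: "(\<Sum>t. \<alpha> ^ t * (a (Suc t) - a t)) = (1 - \<alpha>) * ?s - a 0"
    by (simp add: algebra_simps)
  have "\<bar>?s\<bar> \<le> (\<Sum>t. C * \<alpha> ^ t)"
  proof (rule order_trans[OF summable_rabs suminf_le])
    show "summable (\<lambda>t. \<bar>\<alpha> ^ t * a (Suc t)\<bar>)"
      using sm[of "\<lambda>t. \<bar>a (Suc t)\<bar>"] a \<alpha> by (simp add: abs_mult)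
    then show "summable (\<lambda>t. \<bar>\<alpha> ^ t * a (Suc t)\<bar>)" .
    show "summable (\<lambda>t. C * \<alpha> ^ t)" using \<alpha> by (intro summable_mult summable_geometric) auto
    show "\<bar>\<alpha> ^ t * a (Suc t)\<bar> \<le> C * \<alpha> ^ t" for t
      using \<alpha> a by (simp add: abs_mult mult.commute mult_left_mono)
  qed
  also have "\<dots> = C * (1 / (1 - \<alpha>))"
    using \<alpha> by (subst suminf_mult) (auto simp: suminf_geometric summable_geometric)
  finally have "\<bar>?s\<bar> * (1 - \<alpha>) \<le> C" using \<alpha> by (simp add: pos_le_divide_eq)
  then have "\<bar>(1 - \<alpha>) * ?s\<bar> \<le> C" using \<alpha> by (simp add: abs_mult mult.commute)
  then have "\<bar>(1 - \<alpha>) * ?s - a 0\<bar> \<le> 2 * C" using a[of 0] by linarith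
  moreover have "(\<integral>z. \<phi> (Some (f z)) - \<phi> (Some (fst z)) \<partial>\<nu>)
      = (1 - \<alpha>) * (\<Sum>t. \<alpha> ^ t * (a (Suc t) - a t))"
    using integral_disc_occ[where z = "process f y u", OF G \<alpha> measurable_increment increment_bound]
    unfolding \<nu>_eq increment_process a_def by simp
  ultimately show ?thesis using \<alpha> unfolding tele by (simp add: abs_mult mult.commute mult_left_mono)
qed

end

section \<open>The limits of the convex hulls\<close>

text \<open>The duality principle for the cone maxima. The hypothesis \<open>ge\<close> is the inequality that dynamic
  programming provides for the sets of occupational measures.\<close>
lemma co_cone_max_approximation:
  fixes d :: "nat \<Rightarrow> 'a \<times> 'u"
  assumes \<gamma>: "\<gamma> \<in> borel_prob (top_of_set G)" and A: "A \<subseteq> borel_prob (top_of_set G)"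
    and ge: "\<And>(q :: 'a \<times> 'u \<Rightarrow> real) C e. 0 < e \<Longrightarrow> continuous_on G q \<Longrightarrow> (\<And>z. z \<in> G \<Longrightarrow> \<bar>q z\<bar> \<le> C) \<Longrightarrow>
      \<exists>\<nu>\<in>A. integral\<^sup>L \<gamma> q - e \<le> integral\<^sup>L \<nu> q"
    and N: "finite N" and e: "0 < e"
  shows "\<exists>\<nu>\<in>co (top_of_set G) A.
    (\<Sum>L\<in>N. (integral\<^sup>L \<nu> (cone_max d L) - integral\<^sup>L \<gamma> (cone_max d L))\<^sup>2) < e"
proof -
  obtain C where C: "\<And>L z. \<bar>cone_max d L z\<bar> \<le> C L" using cone_max_bounded[of d] by metis
  show ?thesis
  proof (rule co_moment_approximation[OF A _ N e, of _ _ C])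
    show "\<gamma> \<in> borel_prob (top_of_set G)" by (rule \<gamma>)
    show "cone_max d L \<in> borel_measurable (borel_of (top_of_set G))" for L
      by (rule measurable_G[OF continuous_on_cone_max])
    show "\<bar>cone_max d L z\<bar> \<le> C L" for L z by (rule C)
    fix l :: "(rat \<times> nat \<times> nat) list \<Rightarrow> real" and e :: real assume "0 < e"
    then show "\<exists>\<nu>\<in>A. (\<integral>z. (\<Sum>L\<in>N. l L * cone_max d L z) \<partial>\<gamma>) - e \<le> (\<integral>z. (\<Sum>L\<in>N. l L * cone_max d L z) \<partial>\<nu>)"
    proof (rule ge)
      show "continuous_on G (\<lambda>z. \<Sum>L\<in>N. l L * cone_max d L z)"
        by (intro continuous_intros continuous_on_cone_max)
      show "\<bar>\<Sum>L\<in>N. l L * cone_max d L z\<bar> \<le> (\<Sum>L\<in>N. \<bar>l L\<bar> * C L)" for z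
      proof (rule order_trans[OF sum_abs sum_mono])
        show "\<bar>l L * cone_max d L z\<bar> \<le> \<bar>l L\<bar> * C L" for L
          unfolding abs_mult by (intro mult_left_mono C abs_ge_zero)
      qed
    qed
  qed
qed

text \<open>For the \<open>k\<close>-th parameter, match the integrals of the cone maxima with code at most \<open>k\<close> up to an error that
  tends to 0. Each fixed cone maximum is matched from some index on, and these functions determine
  weak convergence.\<close>
lemma W_subset_set_liminf:
  assumes prob: "\<And>p. p \<in> I \<Longrightarrow> A p \<subseteq> borel_prob (top_of_set G)"
    and ge: "\<And>\<gamma> p (q :: 'a \<times> 'u \<Rightarrow> real) C e. \<gamma> \<in> W Y U f \<Longrightarrow> p \<in> I \<Longrightarrow> 0 < e \<Longrightarrow> continuous_on G q \<Longrightarrow>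
      (\<And>z. z \<in> G \<Longrightarrow> \<bar>q z\<bar> \<le> C) \<Longrightarrow> \<exists>\<nu>\<in>A p. integral\<^sup>L \<gamma> q - e \<le> integral\<^sup>L \<nu> q"
    and \<gamma>: "\<gamma> \<in> W Y U f"
  shows "ext_measure G \<gamma> \<in> set_liminf (compactif G) I F (\<lambda>p. ext_measure G ` co (top_of_set G) (A p))"
proof -
  have \<gamma>p: "\<gamma> \<in> borel_prob (top_of_set G)" using \<gamma> by (simp add: W_def)
  obtain d :: "nat \<Rightarrow> 'a \<times> 'u" where "\<And>z e. z \<in> UNIV \<times> U0 \<Longrightarrow> 0 < e \<Longrightarrow> \<exists>j. dist z (d j) < e"
    using dense_sequence_Times[OF compact_U0] by metis
  then have dense: "\<And>z e. z \<in> G \<Longrightarrow> 0 < e \<Longrightarrow> \<exists>j. dist z (d j) < e" using G_subset by blast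
  have "\<exists>\<mu>. (\<forall>k. \<mu> k \<in> ext_measure G ` co (top_of_set G) (A (s k))) \<and> weak_star_conv (compactif G) \<mu> (ext_measure G \<gamma>)"
    if s: "\<forall>k. s k \<in> I" for s
  proof -
    let ?err = "\<lambda>\<nu> L. (integral\<^sup>L \<nu> (cone_max d L) - integral\<^sup>L \<gamma> (cone_max d L))\<^sup>2"
    have "\<exists>\<nu>\<in>co (top_of_set G) (A (s k)). (\<Sum>L\<in>from_nat ` {..k}. ?err \<nu> L) < 1 / real (Suc k)" for k
    proof (rule co_cone_max_approximation[OF \<gamma>p])
      show "A (s k) \<subseteq> borel_prob (top_of_set G)" using s prob by blast
      show "\<exists>\<nu>\<in>A (s k). integral\<^sup>L \<gamma> q - e \<le> integral\<^sup>L \<nu> q"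
        if "0 < e" "continuous_on G q" "\<And>z. z \<in> G \<Longrightarrow> \<bar>q z\<bar> \<le> C" for q :: "'a \<times> 'u \<Rightarrow> real" and C e
        using s by (intro ge[OF \<gamma> _ that]) auto
    qed auto
    then have "\<forall>k. \<exists>\<nu>. \<nu> \<in> co (top_of_set G) (A (s k)) \<and> (\<Sum>L\<in>from_nat ` {..k}. ?err \<nu> L) < 1 / real (Suc k)"
      by blast
    from choice[OF this] obtain \<nu> where \<nu>: "\<And>k. \<nu> k \<in> co (top_of_set G) (A (s k))"
      "\<And>k. (\<Sum>L\<in>from_nat ` {..k}. ?err (\<nu> k) L) < 1 / real (Suc k)" by blast
    have \<nu>p: "\<And>k. \<nu> k \<in> borel_prob (top_of_set G)" using \<nu>(1) by (simp add: co_def)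
    have conv: "(\<lambda>k. integral\<^sup>L (\<nu> k) (cone_max d L)) \<longlonglongrightarrow> integral\<^sup>L \<gamma> (cone_max d L)" for L
    proof -
      have "(\<lambda>k. ?err (\<nu> k) L) \<longlonglongrightarrow> 0"
      proof (rule real_tendsto_sandwich[where f = "\<lambda>_. 0" and h = "\<lambda>k. 1 / real (Suc k)"])
        show "(\<lambda>k. 1 / real (Suc k)) \<longlonglongrightarrow> 0" using LIMSEQ_inverse_real_of_nat by (simp add: inverse_eq_divide)
        have "?err (\<nu> k) L \<le> 1 / real (Suc k)" if "to_nat L \<le> k" for k
        proof -
          have "L \<in> from_nat ` {..k}" using that by (intro image_eqI[of _ _ "to_nat L"]) auto
          then have "?err (\<nu> k) L \<le> (\<Sum>L\<in>from_nat ` {..k}. ?err (\<nu> k) L)"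
            by (intro member_le_sum) auto
          then show ?thesis using \<nu>(2)[of k] by linarith
        qed
        then show "\<forall>\<^sub>F k in sequentially. ?err (\<nu> k) L \<le> 1 / real (Suc k)"
          unfolding eventually_sequentially by blast
      qed auto
      then have "(\<lambda>k. sqrt (?err (\<nu> k) L)) \<longlonglongrightarrow> sqrt 0" by (rule tendsto_real_sqrt)
      then have "(\<lambda>k. \<bar>integral\<^sup>L (\<nu> k) (cone_max d L) - integral\<^sup>L \<gamma> (cone_max d L)\<bar>) \<longlonglongrightarrow> 0"
        by (simp only: real_sqrt_abs real_sqrt_zero)
      then have "(\<lambda>k. integral\<^sup>L (\<nu> k) (cone_max d L) - integral\<^sup>L \<gamma> (cone_max d L)) \<longlonglongrightarrow> 0"
        by (rule tendsto_rabs_zero_cancel)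
      then show ?thesis by (rule LIM_zero_cancel)
    qed
    have "weak_star_conv (compactif G) (\<lambda>k. ext_measure G (\<nu> k)) (ext_measure G \<gamma>)"
      unfolding weak_star_conv_def
    proof (intro allI impI)
      fix q :: "('a \<times> 'u) option \<Rightarrow> real" assume q: "continuous_map (compactif G) euclideanreal q"
      obtain C where C: "\<And>x. x \<in> topspace (compactif G) \<Longrightarrow> \<bar>q x\<bar> \<le> C"
        using continuous_map_compactif_bounded[OF q] by blast
      have "(\<lambda>k. \<integral>z. q (Some z) \<partial>\<nu> k) \<longlonglongrightarrow> (\<integral>z. q (Some z) \<partial>\<gamma>)"
      proof (rule cone_max_convergence_determining[OF dense \<nu>p \<gamma>p conv])
        show "continuous_on G (\<lambda>z. q (Some z))" using continuous_map_compactif_Some[OF q] by simp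
        show "\<bar>q (Some z)\<bar> \<le> C" if "z \<in> G" for z using C that by simp
      qed
      then show "(\<lambda>k. integral\<^sup>L (ext_measure G (\<nu> k)) q) \<longlonglongrightarrow> integral\<^sup>L (ext_measure G \<gamma>) q"
        by (simp add: integral_ext_measure[OF _ q] \<nu>p \<gamma>p)
    qed
    then show ?thesis using \<nu>(1) by (intro exI[of _ "\<lambda>k. ext_measure G (\<nu> k)"]) auto
  qed
  then show ?thesis
    using ext_measure_in[OF \<gamma>p] by (auto simp: set_liminf_def prob_no_infinity_def)
qed

text \<open>The bound on the increments is stable under convex combinations and tends to 0 along the
  parameters; the increment being continuous on the compactification, its integral against the
  limit vanishes.\<close>
lemma set_limsup_subset_W:
  fixes r :: "'p \<Rightarrow> real"
  assumes prob: "\<And>p. p \<in> I \<Longrightarrow> A p \<subseteq> borel_prob (top_of_set G)"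
    and incr: "\<And>\<phi> C p \<nu>. continuous_map (compactif Y) euclideanreal \<phi> \<Longrightarrow> (\<And>y. y \<in> Y \<Longrightarrow> \<bar>\<phi> (Some y)\<bar> \<le> C) \<Longrightarrow>
      p \<in> I \<Longrightarrow> \<nu> \<in> A p \<Longrightarrow> \<bar>\<integral>z. \<phi> (Some (f z)) - \<phi> (Some (fst z)) \<partial>\<nu>\<bar> \<le> 2 * C * r p"
    and r: "(r \<longlongrightarrow> 0) F"
    and \<gamma>': "\<gamma>' \<in> set_limsup (compactif G) I F (\<lambda>p. ext_measure G ` co (top_of_set G) (A p))"
      "\<gamma>' \<in> prob_no_infinity G"
  shows "\<gamma>' \<in> ext_measure G ` W Y U f"
proof -
  obtain \<gamma> where \<gamma>: "\<gamma> \<in> borel_prob (top_of_set G)" "ext_measure G \<gamma> = \<gamma>'"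
    using prob_no_infinity_ext_measure[OF \<gamma>'(2) G_nonempty] by blast
  obtain s \<mu> where s: "\<And>k. s k \<in> I" "filterlim s F sequentially"
    and \<mu>: "\<And>k. \<mu> k \<in> ext_measure G ` co (top_of_set G) (A (s k))"
    and conv: "weak_star_conv (compactif G) \<mu> \<gamma>'"
    using \<gamma>'(1) by (auto simp: set_limsup_def)
  obtain \<nu> where \<nu>: "\<And>k. \<nu> k \<in> co (top_of_set G) (A (s k))" "\<And>k. \<mu> k = ext_measure G (\<nu> k)"
    using \<mu> unfolding image_iff Bex_def by metis
  have "(\<integral>z. \<phi> (Some (f z)) - \<phi> (Some (fst z)) \<partial>\<gamma>) = 0"
    if \<phi>: "continuous_map (compactif Y) euclideanreal \<phi>" for \<phi>
  proof -
    let ?h = "\<lambda>z. \<phi> (map_option f z) - \<phi> (map_option fst z)"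
    note h = continuous_map_increment[OF \<phi>]
    obtain C where "\<And>y. y \<in> topspace (compactif Y) \<Longrightarrow> \<bar>\<phi> y\<bar> \<le> C"
      using continuous_map_compactif_bounded[OF \<phi>] by blast
    then have C: "\<And>y. y \<in> Y \<Longrightarrow> \<bar>\<phi> (Some y)\<bar> \<le> C" by simp
    have lim: "(\<lambda>k. integral\<^sup>L (\<mu> k) ?h) \<longlonglongrightarrow> integral\<^sup>L \<gamma>' ?h"
      using conv h by (simp add: weak_star_conv_def)
    have bound: "\<bar>integral\<^sup>L (\<mu> k) ?h\<bar> \<le> 2 * C * r (s k)" for k
    proof -
      let ?g = "\<lambda>z. \<phi> (Some (f z)) - \<phi> (Some (fst z))"
      obtain F w where F: "finite F" "F \<subseteq> A (s k)" "\<forall>\<nu>\<in>F. 0 \<le> w \<nu>" "sum w F = 1"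
        "\<forall>Q\<in>sets (borel_of (top_of_set G)). measure (\<nu> k) Q = (\<Sum>\<nu>\<in>F. w \<nu> * measure \<nu> Q)"
        and \<nu>p: "\<nu> k \<in> borel_prob (top_of_set G)"
        using \<nu>(1)[of k] by (auto simp: co_def)
      have "integral\<^sup>L (\<mu> k) ?h = integral\<^sup>L (\<nu> k) ?g"
        unfolding \<nu>(2) using integral_ext_measure[OF \<nu>p h] by simp
      also have "\<dots> = (\<Sum>\<nu>\<in>F. w \<nu> * integral\<^sup>L \<nu> ?g)"
      proof (rule integral_convex_combination[OF \<nu>p F(1) _ F(3-5) measurable_increment[OF \<phi> C]])
        show "F \<subseteq> borel_prob (top_of_set G)" using F(2) prob[OF s(1)[of k]] by blast
        show "\<bar>?g z\<bar> \<le> 2 * C" if "z \<in> topspace (top_of_set G)" for z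
          using increment_bound[OF \<phi> C] that by simp
      qed
      also have "\<bar>\<dots>\<bar> \<le> (\<Sum>\<nu>\<in>F. w \<nu> * (2 * C * r (s k)))"
      proof (rule order_trans[OF sum_abs sum_mono])
        fix \<nu>' assume \<nu>': "\<nu>' \<in> F"
        then have "\<bar>integral\<^sup>L \<nu>' ?g\<bar> \<le> 2 * C * r (s k)" using F(2) by (intro incr[OF \<phi> C s(1)]) auto
        then show "\<bar>w \<nu>' * integral\<^sup>L \<nu>' ?g\<bar> \<le> w \<nu>' * (2 * C * r (s k))"
          using F(3) \<nu>' by (simp add: abs_mult mult_left_mono)
      qed
      also have "\<dots> = 2 * C * r (s k)" using F(4) by (simp add: sum_distrib_right[symmetric])
      finally show ?thesis .
    qed
    have "(\<lambda>k. 2 * C * r (s k)) \<longlonglongrightarrow> 2 * C * 0"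
      by (intro tendsto_intros filterlim_compose[OF r s(2)])
    then have "(\<lambda>k. 2 * C * r (s k)) \<longlonglongrightarrow> 0" by simp
    then have "(\<lambda>k. integral\<^sup>L (\<mu> k) ?h) \<longlonglongrightarrow> 0"
      by (rule Lim_null_comparison[rotated]) (simp add: bound)
    then have "integral\<^sup>L \<gamma>' ?h = 0" by (rule LIMSEQ_unique[OF lim])
    then show ?thesis using integral_ext_measure[OF \<gamma>(1) h] \<gamma>(2) by simp
  qed
  then have "\<gamma> \<in> W Y U f" using \<gamma>(1) by (simp add: W_def case_prod_unfold)
  then show ?thesis using \<gamma>(2) by blast
qed

text \<open>The common form of both statements. The sequence \<open>s\<close> only witnesses that the parameters can
  converge at all, without which the lower limit would not be contained in the upper one.\<close>
lemma set_limits_eq_W: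
  fixes r :: "'p \<Rightarrow> real"
  assumes prob: "\<And>p. p \<in> I \<Longrightarrow> A p \<subseteq> borel_prob (top_of_set G)"
    and ge: "\<And>\<gamma> p (q :: 'a \<times> 'u \<Rightarrow> real) C e. \<gamma> \<in> W Y U f \<Longrightarrow> p \<in> I \<Longrightarrow> 0 < e \<Longrightarrow> continuous_on G q \<Longrightarrow>
      (\<And>z. z \<in> G \<Longrightarrow> \<bar>q z\<bar> \<le> C) \<Longrightarrow> \<exists>\<nu>\<in>A p. integral\<^sup>L \<gamma> q - e \<le> integral\<^sup>L \<nu> q"
    and incr: "\<And>\<phi> C p \<nu>. continuous_map (compactif Y) euclideanreal \<phi> \<Longrightarrow> (\<And>y. y \<in> Y \<Longrightarrow> \<bar>\<phi> (Some y)\<bar> \<le> C) \<Longrightarrow>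
      p \<in> I \<Longrightarrow> \<nu> \<in> A p \<Longrightarrow> \<bar>\<integral>z. \<phi> (Some (f z)) - \<phi> (Some (fst z)) \<partial>\<nu>\<bar> \<le> 2 * C * r p"
    and r: "(r \<longlongrightarrow> 0) F"
    and seq: "\<And>k. s k \<in> I" "filterlim s F sequentially"
  defines "B \<equiv> \<lambda>p. ext_measure G ` co (top_of_set G) (A p)"
  shows "set_liminf (compactif G) I F B \<inter> prob_no_infinity G = set_limsup (compactif G) I F B \<inter> prob_no_infinity G
    \<and> set_limsup (compactif G) I F B \<inter> prob_no_infinity G = ext_measure G ` W Y U f"
proof -
  have "set_liminf (compactif G) I F B \<subseteq> set_limsup (compactif G) I F B"
    using seq unfolding set_liminf_def set_limsup_def by blast
  moreover have "ext_measure G ` W Y U f \<subseteq> set_liminf (compactif G) I F B \<inter> prob_no_infinity G"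
  proof (intro image_subsetI IntI)
    fix \<gamma> assume \<gamma>: "\<gamma> \<in> W Y U f"
    show "ext_measure G \<gamma> \<in> set_liminf (compactif G) I F B"
      unfolding B_def by (rule W_subset_set_liminf[OF prob ge \<gamma>])
    show "ext_measure G \<gamma> \<in> prob_no_infinity G" using \<gamma> by (intro ext_measure_in) (simp add: W_def)
  qed
  moreover have "set_limsup (compactif G) I F B \<inter> prob_no_infinity G \<subseteq> ext_measure G ` W Y U f"
  proof (rule subsetI, elim IntE)
    fix \<gamma>' assume "\<gamma>' \<in> set_limsup (compactif G) I F B" and 2: "\<gamma>' \<in> prob_no_infinity G"
    then have 1: "\<gamma>' \<in> set_limsup (compactif G) I F (\<lambda>p. ext_measure G ` co (top_of_set G) (A p))"
      by (simp add: B_def)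
    show "\<gamma>' \<in> ext_measure G ` W Y U f" by (rule set_limsup_subset_W[OF prob incr r 1 2])
  qed
  ultimately show ?thesis by blast
qed

lemma disc_limits_eq_W:
  defines "B \<equiv> \<lambda>\<alpha>. ext_measure G ` co (top_of_set G) (Gamma_disc Y U f \<alpha>)"
  shows "set_liminf (compactif G) {0<..<1} (at_left 1) B \<inter> prob_no_infinity G
      = set_limsup (compactif G) {0<..<1} (at_left 1) B \<inter> prob_no_infinity G
    \<and> set_limsup (compactif G) {0<..<1} (at_left 1) B \<inter> prob_no_infinity G = ext_measure G ` W Y U f"
  unfolding B_def
proof (rule set_limits_eq_W[where r = "\<lambda>\<alpha>. 1 - \<alpha>" and s = "\<lambda>k. 1 - 1 / real (k + 2)"])
  show "((\<lambda>\<alpha>::real. 1 - \<alpha>) \<longlongrightarrow> 0) (at_left 1)" by (auto intro!: tendsto_eq_intros)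
  show "1 - 1 / real (k + 2) \<in> {0<..<1}" for k by (simp add: field_simps)
  have "(\<lambda>k. 1 - 1 / real (k + 2)) \<longlonglongrightarrow> 1 - 0"
    by (intro tendsto_intros LIMSEQ_ignore_initial_segment[OF lim_1_over_n])
  then show "filterlim (\<lambda>k. 1 - 1 / real (k + 2)) (at_left 1) sequentially"
    by (intro filterlim_at_withinI) (auto intro!: always_eventually)
  fix \<alpha> :: real assume "\<alpha> \<in> {0<..<1}"
  then have \<alpha>: "0 < \<alpha>" "\<alpha> < 1" by auto
  show "Gamma_disc Y U f \<alpha> \<subseteq> borel_prob (top_of_set G)" by (rule Gamma_disc_borel_prob[OF \<alpha>])
  show "\<exists>\<nu>\<in>Gamma_disc Y U f \<alpha>. integral\<^sup>L \<gamma> q - e \<le> integral\<^sup>L \<nu> q"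
    if "\<gamma> \<in> W Y U f" "0 < e" "continuous_on G q" "\<And>z. z \<in> G \<Longrightarrow> \<bar>q z\<bar> \<le> C"
    for \<gamma> and q :: "'a \<times> 'u \<Rightarrow> real" and C e
    by (rule Gamma_disc_ge[OF that(1) \<alpha> that(2-)])
  show "\<bar>\<integral>z. \<phi> (Some (f z)) - \<phi> (Some (fst z)) \<partial>\<nu>\<bar> \<le> 2 * C * (1 - \<alpha>)"
    if "continuous_map (compactif Y) euclideanreal \<phi>" "\<And>y. y \<in> Y \<Longrightarrow> \<bar>\<phi> (Some y)\<bar> \<le> C"
      "\<nu> \<in> Gamma_disc Y U f \<alpha>" for \<phi> C \<nu>
    by (rule Gamma_disc_increment[OF that(1,2) \<alpha> that(3)])
qed

lemma avg_limits_eq_W: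
  defines "B \<equiv> \<lambda>S. ext_measure G ` co (top_of_set G) (Gamma_avg Y U f S)"
  shows "set_liminf (compactif G) {1..} at_top B \<inter> prob_no_infinity G
      = set_limsup (compactif G) {1..} at_top B \<inter> prob_no_infinity G
    \<and> set_limsup (compactif G) {1..} at_top B \<inter> prob_no_infinity G = ext_measure G ` W Y U f"
  unfolding B_def
proof (rule set_limits_eq_W[where r = "\<lambda>S. 1 / real S" and s = Suc])
  show "(\<lambda>S. 1 / real S) \<longlonglongrightarrow> 0" by (rule lim_1_over_n)
  show "filterlim Suc at_top sequentially" by (rule filterlim_Suc)
  fix S :: nat
  show "Suc S \<in> {1..}" by simp
  assume "S \<in> {1..}"
  then have S: "0 < S" by auto
  show "Gamma_avg Y U f S \<subseteq> borel_prob (top_of_set G)" by (rule Gamma_avg_borel_prob[OF S])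
  show "\<exists>\<nu>\<in>Gamma_avg Y U f S. integral\<^sup>L \<gamma> q - e \<le> integral\<^sup>L \<nu> q"
    if "\<gamma> \<in> W Y U f" "0 < e" "continuous_on G q" "\<And>z. z \<in> G \<Longrightarrow> \<bar>q z\<bar> \<le> C"
    for \<gamma> and q :: "'a \<times> 'u \<Rightarrow> real" and C e
    by (rule Gamma_avg_ge[OF that(1) S that(2-)])
  show "\<bar>\<integral>z. \<phi> (Some (f z)) - \<phi> (Some (fst z)) \<partial>\<nu>\<bar> \<le> 2 * C * (1 / real S)"
    if "continuous_map (compactif Y) euclideanreal \<phi>" "\<And>y. y \<in> Y \<Longrightarrow> \<bar>\<phi> (Some y)\<bar> \<le> C"
      "\<nu> \<in> Gamma_avg Y U f S" for \<phi> C \<nu>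
    by (rule Gamma_avg_increment[OF that(1,2) S that(3)])
qed

end

theorem theorem4p3:
  fixes Y :: "(real ^ 'm) set"
    and U0 :: "('u::metric_space) set"
    and U :: "real ^ 'm \<Rightarrow> 'u set"
    and f :: "(real ^ 'm) \<times> 'u \<Rightarrow> real ^ 'm"
    and G :: "((real ^ 'm) \<times> 'u) set"
  assumes Y: "Y \<noteq> {}" "closed Y" "\<not> bounded Y"
    and U0: "compact U0"
    and U: "\<And>y. y \<in> Y \<Longrightarrow> U y \<subseteq> U0" "\<And>y. y \<in> Y \<Longrightarrow> compact (U y)" "usc_on Y U"
    and f_cont: "continuous_on (UNIV \<times> U0) f"
    and f_inf: "\<And>M. \<forall>\<^sub>F y in at_infinity. \<forall>u\<in>U0. M \<le> norm (f (y, u))"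
    and viable: "\<And>y0. y0 \<in> Y \<Longrightarrow> controls Y U f y0 \<noteq> {}"
    and G: "G = graph_G Y U f"
  shows
    "(set_liminf (compactif G) {0<..<1} (at_left 1)
         (\<lambda>\<alpha>. ext_measure G ` co (top_of_set G) (Gamma_disc Y U f \<alpha>)) \<inter> prob_no_infinity G
       = set_limsup (compactif G) {0<..<1} (at_left 1)
         (\<lambda>\<alpha>. ext_measure G ` co (top_of_set G) (Gamma_disc Y U f \<alpha>)) \<inter> prob_no_infinity G
      \<and> set_limsup (compactif G) {0<..<1} (at_left 1)
         (\<lambda>\<alpha>. ext_measure G ` co (top_of_set G) (Gamma_disc Y U f \<alpha>)) \<inter> prob_no_infinity G
       = ext_measure G ` W Y U f)
     \<and>
     (set_liminf (compactif G) {1..} at_top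
         (\<lambda>S. ext_measure G ` co (top_of_set G) (Gamma_avg Y U f S)) \<inter> prob_no_infinity G
       = set_limsup (compactif G) {1..} at_top
         (\<lambda>S. ext_measure G ` co (top_of_set G) (Gamma_avg Y U f S)) \<inter> prob_no_infinity G
      \<and> set_limsup (compactif G) {1..} at_top
         (\<lambda>S. ext_measure G ` co (top_of_set G) (Gamma_avg Y U f S)) \<inter> prob_no_infinity G
       = ext_measure G ` W Y U f)"
proof -
  interpret control_system Y U0 U f
    using Y(1,2) U0 U f_cont f_inf viable by unfold_locales
  show ?thesis unfolding G using disc_limits_eq_W avg_limits_eq_W by blast
qed

end
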